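(* Let $n$ be a positive integer and consider functions $D$ from the family of compact subsets of $\mathbb{R}^n$ to $[0,n]$ with the following property: $(\star)$ $D$ is bilipschitz invariant (i.e. $D(A)=D(B)$ whenever the compact sets $A,B\subset\mathbb{R}^n$ are bilipschitz equivalent), $D$ is monotone (i.e. $A\subset B$ implies $D(A)\le D(B)$), and $D(S)$ equals the similarity dimension of $S$ for every homogeneous self-similar set $S\subset\mathbb{R}^n$ satisfying the strong separation condition. Then: (a) If $D$ satisfies $(\star)$, then $\dim_{ML}(K)\le D(K)$ for every compact set $K\subset\mathbb{R}^n$. (b) If $n=1$ and $D$ satisfies $(\star)$, then also $D(K)\le\dim_A K$ for every compact set $K\subset\mathbb{R}$. (c) For every $n>1$ the statement in (b) fails in $\mathbb{R}^n$: there exist a function $D$ from the family of compact subsets of $\mathbb{R}^n$ to $[0,n]$ satisfying $(\star)$ and a compact set $K\subset\mathbb{R}^n$ with $D(K)>\dim_A K$.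
   Context: Two metric spaces $X,Y$ are bilipschitz equivalent if there is a bijection $f\colon X\to Y$ such that $f$ and $f^{-1}$ are both Lipschitz (subsets of $\mathbb{R}^n$ carry the Euclidean metric). A self-similar set is a nonempty compact $S\subset\mathbb{R}^n$ with $S=\bigcup_{i=1}^m f_i(S)$ for finitely many contracting similarity maps $f_i$ of $\mathbb{R}^n$ with similarity ratios $r_i$. Its similarity dimension is the unique $s$ with $r_1^s+\dots+r_m^s=1$. It is homogeneous if $r_1=\dots=r_m$, and satisfies the strong separation condition (SSC) if $f_i(S)\cap f_j(S)=\emptyset$ for all $i\ne j$. $B(x,R)$ is the closed ball of center $x$ and radius $R$; $N(X,r)$ is the minimal number of closed balls of radius $r$ that cover $X$. Assouad dimension of $X\subset\mathbb{R}^n$: $\dim_A X$ is the infimum of those $\alpha\ge 0$ for which there is $C>0$ such that $N(B(x,R)\cap X,r)\le C(R/r)^\alpha$ for all $0<r<R$ and all $x\in X$. Lower dimension of $X\subset\mathbb{R}^n$: if $X$ has at least two points, $\dim_L X$ is the supremum of those $\alpha\ge0$ for which there is $C>0$ such that $N(B(x,R)\cap X,r)\ge C(R/r)^\alpha$ for all $0<r<R\le\operatorname{diam}X$ and all $x\in X$; if $X$ has at most one point, $\dim_L X=0$. Modified lower dimension: $\dim_{ML}X=\sup\{\dim_L E: E\subset X\}$. *)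

theory Defs
  imports "HOL-Analysis.Analysis"
begin

definition bilipschitz_equivalent ::
    "'a::metric_space set \<Rightarrow> 'b::metric_space set \<Rightarrow> bool" where
  "bilipschitz_equivalent X Y \<longleftrightarrow>
     (\<exists>f. bij_betw f X Y \<and> (\<exists>L. L-lipschitz_on X f) \<and> (\<exists>L. L-lipschitz_on Y (inv_into X f)))"

definition contracting_similarity :: "real \<Rightarrow> ('a::metric_space \<Rightarrow> 'a) \<Rightarrow> bool" where
  "contracting_similarity r f \<longleftrightarrow>
     0 < r \<and> r < 1 \<and> (\<forall>x y. dist (f x) (f y) = r * dist x y)"

text \<open>The maps of a system are \<open>f 0, \<dots>, f (m - 1)\<close>, with similarity ratios
  \<open>r 0, \<dots>, r (m - 1)\<close>. Nonemptiness of \<open>S\<close> forces \<open>m \<ge> 1\<close>.\<close>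

definition self_similar_by ::
    "nat \<Rightarrow> (nat \<Rightarrow> 'a::metric_space \<Rightarrow> 'a) \<Rightarrow> (nat \<Rightarrow> real) \<Rightarrow> 'a set \<Rightarrow> bool" where
  "self_similar_by m f r S \<longleftrightarrow>
     S \<noteq> {} \<and> compact S \<and> (\<forall>i<m. contracting_similarity (r i) (f i)) \<and>
     S = (\<Union>i<m. f i ` S)"

definition homogeneous_ratios :: "nat \<Rightarrow> (nat \<Rightarrow> real) \<Rightarrow> bool" where
  "homogeneous_ratios m r \<longleftrightarrow> (\<forall>i<m. \<forall>j<m. r i = r j)"

definition strong_separation :: "nat \<Rightarrow> (nat \<Rightarrow> 'a \<Rightarrow> 'a) \<Rightarrow> 'a set \<Rightarrow> bool" where
  "strong_separation m f S \<longleftrightarrow> (\<forall>i<m. \<forall>j<m. i \<noteq> j \<longrightarrow> f i ` S \<inter> f j ` S = {})"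

text \<open>For \<open>m \<ge> 1\<close> and ratios in \<open>(0, 1)\<close> the sum is strictly decreasing in \<open>s\<close>, with limits
  \<open>\<infinity>\<close> and \<open>0\<close>, so exactly one real \<open>s\<close> satisfies the equation.\<close>

definition similarity_dimension :: "nat \<Rightarrow> (nat \<Rightarrow> real) \<Rightarrow> real" where
  "similarity_dimension m r = (THE s. (\<Sum>i<m. r i powr s) = 1)"

text \<open>Ball centres range over the ambient space. The value is meaningful when \<open>X\<close> has a finite
  cover of this kind, as every bounded subset of a Euclidean space does for \<open>r > 0\<close>.\<close>

definition covering_number :: "'a::metric_space set \<Rightarrow> real \<Rightarrow> nat" where
  "covering_number X r =
     (LEAST k. \<exists>F. finite F \<and> card F = k \<and> X \<subseteq> (\<Union>c\<in>F. cball c r))"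

text \<open>The infimum and suprema below are taken over nonempty sets of reals contained in
  \<open>[0, \<infinity>)\<close>; the suprema are bounded by the dimension of the ambient space.\<close>

definition assouad_dim :: "'a::euclidean_space set \<Rightarrow> real" where
  "assouad_dim X =
     Inf {\<alpha>. 0 \<le> \<alpha> \<and>
       (\<exists>C>0. \<forall>x\<in>X. \<forall>r R. 0 < r \<and> r < R \<longrightarrow>
          real (covering_number (cball x R \<inter> X) r) \<le> C * (R / r) powr \<alpha>)}"

text \<open>The library's \<open>diameter\<close> is only meaningful on bounded sets; an unbounded set has infinite
  diameter and so imposes no upper bound on \<open>R\<close>.\<close>

definition lower_dim :: "'a::euclidean_space set \<Rightarrow> real" where
  "lower_dim X =
     (if \<exists>x\<in>X. \<exists>y\<in>X. x \<noteq> y then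
        Sup {\<alpha>. 0 \<le> \<alpha> \<and>
          (\<exists>C>0. \<forall>x\<in>X. \<forall>r R. 0 < r \<and> r < R \<and> (bounded X \<longrightarrow> R \<le> diameter X) \<longrightarrow>
             real (covering_number (cball x R \<inter> X) r) \<ge> C * (R / r) powr \<alpha>)}
      else 0)"

definition modified_lower_dim :: "'a::euclidean_space set \<Rightarrow> real" where
  "modified_lower_dim X = Sup {lower_dim E | E. E \<subseteq> X}"

text \<open>Functions \<open>D\<close> from the compact subsets of the space to \<open>[0, n]\<close> with property \<open>(\<star>)\<close>, where
  \<open>n\<close> is the dimension of the space; the values of \<open>D\<close> on noncompact sets are irrelevant.\<close>

definition dimension_like :: "('a::euclidean_space set \<Rightarrow> real) \<Rightarrow> bool" where
  "dimension_like D \<longleftrightarrow>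
     (\<forall>K. compact K \<longrightarrow> 0 \<le> D K \<and> D K \<le> real DIM('a)) \<and>
     (\<forall>A B. compact A \<and> compact B \<and> bilipschitz_equivalent A B \<longrightarrow> D A = D B) \<and>
     (\<forall>A B. compact A \<and> compact B \<and> A \<subseteq> B \<longrightarrow> D A \<le> D B) \<and>
     (\<forall>m f r S. self_similar_by m f r S \<and> homogeneous_ratios m r \<and> strong_separation m f S \<longrightarrow>
        D S = similarity_dimension m r)"

end

theory Submission imports Defs begin

text \<open>All comparisons run through symbol sequences. Suppose that the points of a set carry labels in
  \<open>{0, \<dots>, m - 1}\<^sup>\<nat>\<close> such that two points whose labels first differ at position \<open>k\<close> are at a
  distance comparable to \<open>\<rho> ^ k\<close>. Two sets with the same labels and the same \<open>\<rho>\<close> are then bilipschitz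
  equivalent. The full sequence space is realised by a homogeneous self-similar set with strong
  separation, made of \<open>m\<close> maps of ratio \<open>\<rho>\<close>, as soon as the unit ball contains \<open>m\<close> points whose mutual
  distances are at least \<open>8 * \<rho>\<close>, where \<open>8 * \<rho> \<le> 1\<close>. So \<open>D\<close> is at least
  \<open>ln m / ln (1 / \<rho>)\<close> on a compact set that contains a copy of the full sequence space, and at most this number on a compact set that can be
  labelled by \<open>m\<close> symbols (given a self-similar model for them).

  Lower bound. If the balls of \<open>E\<close> satisfy the lower dimension estimate with exponent \<open>\<alpha>\<close>, then every
  ball of radius \<open>R\<close> around a point of \<open>E\<close> contains at least \<open>C * \<kappa> powr - \<alpha>\<close> points of \<open>E\<close> at mutual
  distances above \<open>\<kappa> * R\<close>. Repeating the choice inside balls shrinking by \<open>\<rho> = \<kappa> / 8\<close> gives a copy of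
  the full sequence space in the closure of \<open>E\<close> (\<open>separated_choices_give_coded_set\<close>), and one such
  choice, rescaled to the unit ball, provides the model. As \<open>\<kappa>\<close> tends to 0, the value
  \<open>ln m / ln (1 / \<rho>)\<close> becomes at least as large as any number below \<open>\<alpha>\<close> (\<open>lower_exponent_le\<close>).

  Upper bound on the line. If \<open>K\<close> satisfies the Assouad estimate with exponent \<open>\<alpha> < 1\<close>, then \<open>K\<close> has
  gaps at all scales: points joined by a chain in \<open>K\<close> with steps at most \<open>\<delta>\<close> are at distance at most
  \<open>M * \<delta>\<close>, because a longer chain would be too dense in an interval
  (\<open>chains_have_small_diameter\<close>). The chain classes at the scales \<open>\<rho> ^ k\<close> label \<open>K\<close> with a constant
  times \<open>\<rho> powr - \<alpha>\<close> symbols (\<open>thin_set_has_code\<close>), and for small \<open>\<rho>\<close> the unit interval has room for the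
  model, since \<open>\<alpha> < 1\<close> (\<open>assouad_exponent_ge\<close>).

  Failure in higher dimension. Let \<open>D A\<close> be the infimum of the dimension \<open>n\<close> of the space and of the
  similarity dimensions of those homogeneous, strongly separated self-similar sets into which \<open>A\<close>
  embeds bilipschitzly. It has the right value on self-similar sets because counting separated points
  shows that the similarity dimension cannot drop under an embedding
  (\<open>embedding_dimension_comparison\<close>) and cannot exceed \<open>n\<close> (\<open>self_similar_dimension_le_DIM\<close>). A
  segment embeds into no totally disconnected set, so its value is \<open>n > 1\<close>, although its Assouad
  dimension is at most 1.\<close>

section \<open>Bilipschitz embeddings\<close>

definition bilipschitz_embedding :: "('a::metric_space \<Rightarrow> 'b::metric_space) \<Rightarrow> 'a set \<Rightarrow> bool" where
  "bilipschitz_embedding g A \<longleftrightarrow>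
     (\<exists>L>0. \<forall>x\<in>A. \<forall>y\<in>A. dist (g x) (g y) \<le> L * dist x y \<and> dist x y \<le> L * dist (g x) (g y))"

lemma bilipschitz_embedding_compose:
  assumes "bilipschitz_embedding g A" "bilipschitz_embedding h B" "g ` A \<subseteq> B"
  shows "bilipschitz_embedding (h \<circ> g) A"
proof -
  obtain L where L: "L > 0" "\<And>x y. x \<in> A \<Longrightarrow> y \<in> A \<Longrightarrow> dist (g x) (g y) \<le> L * dist x y"
     "\<And>x y. x \<in> A \<Longrightarrow> y \<in> A \<Longrightarrow> dist x y \<le> L * dist (g x) (g y)"
    using assms(1) unfolding bilipschitz_embedding_def by blast
  obtain M where M: "M > 0" "\<And>x y. x \<in> B \<Longrightarrow> y \<in> B \<Longrightarrow> dist (h x) (h y) \<le> M * dist x y"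
     "\<And>x y. x \<in> B \<Longrightarrow> y \<in> B \<Longrightarrow> dist x y \<le> M * dist (h x) (h y)"
    using assms(2) unfolding bilipschitz_embedding_def by blast
  have "dist (h (g x)) (h (g y)) \<le> (L * M) * dist x y \<and> dist x y \<le> (L * M) * dist (h (g x)) (h (g y))"
    if "x \<in> A" "y \<in> A" for x y
  proof
    have gB: "g x \<in> B" "g y \<in> B" using that assms(3) by auto
    have "dist (h (g x)) (h (g y)) \<le> M * dist (g x) (g y)" using M gB by blast
    also have "\<dots> \<le> M * (L * dist x y)" using L that M(1) by (intro mult_left_mono) auto
    finally show "dist (h (g x)) (h (g y)) \<le> (L * M) * dist x y" by (simp add: mult_ac)
    have "dist x y \<le> L * dist (g x) (g y)" using L that by blast
    also have "\<dots> \<le> L * (M * dist (h (g x)) (h (g y)))" using M gB L(1) by (intro mult_left_mono) auto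
    finally show "dist x y \<le> (L * M) * dist (h (g x)) (h (g y))" by (simp add: mult_ac)
  qed
  then show ?thesis
    unfolding bilipschitz_embedding_def using L(1) M(1) by (intro exI[of _ "L * M"]) auto
qed

lemma bilipschitz_embedding_inj_on: "bilipschitz_embedding g A \<Longrightarrow> inj_on g A"
  unfolding bilipschitz_embedding_def inj_on_def by fastforce

lemma bilipschitz_embedding_continuous_on:
  assumes "bilipschitz_embedding g A"
  shows "continuous_on A g"
proof -
  obtain L where L: "L > 0" "\<And>x y. x \<in> A \<Longrightarrow> y \<in> A \<Longrightarrow> dist (g x) (g y) \<le> L * dist x y"
    using assms unfolding bilipschitz_embedding_def by blast
  then have "L-lipschitz_on A g" by (intro lipschitz_onI) auto
  then show ?thesis by (rule lipschitz_on_continuous_on)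
qed

text \<open>Enlarging the two Lipschitz constants to a common positive one turns a
  bilipschitz equivalence into embeddings in both directions.\<close>

lemma bilipschitz_equivalent_embeddings:
  assumes "bilipschitz_equivalent A B"
  shows "\<exists>g. bilipschitz_embedding g A \<and> g ` A = B" "\<exists>h. bilipschitz_embedding h B \<and> h ` B = A"
proof -
  obtain f L M where f: "bij_betw f A B" and L: "L-lipschitz_on A f"
    and M: "M-lipschitz_on B (inv_into A f)"
    using assms unfolding bilipschitz_equivalent_def by blast
  define N where "N = max 1 (max L M)"
  have N: "N > 0" "L \<le> N" "M \<le> N" unfolding N_def by auto
  have LN: "N-lipschitz_on A f" and MN: "N-lipschitz_on B (inv_into A f)"
    using L M N by (auto intro: lipschitz_on_mono)
  have inv: "inv_into A f (f x) = x" "f x \<in> B" if "x \<in> A" for x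
    using f that by (auto simp: bij_betw_def)
  have inv': "f (inv_into A f y) = y" "inv_into A f y \<in> A" if "y \<in> B" for y
    using f that by (auto simp: bij_betw_def f_inv_into_f inv_into_into)
  have "bilipschitz_embedding f A"
    unfolding bilipschitz_embedding_def
    using N(1) lipschitz_onD[OF LN] lipschitz_onD[OF MN] inv by (intro exI[of _ N]) metis
  moreover have "f ` A = B" using f by (simp add: bij_betw_def)
  ultimately show "\<exists>g. bilipschitz_embedding g A \<and> g ` A = B" by blast
  have "bilipschitz_embedding (inv_into A f) B"
    unfolding bilipschitz_embedding_def
    using N(1) lipschitz_onD[OF LN] lipschitz_onD[OF MN] inv' by (intro exI[of _ N]) metis
  moreover have "inv_into A f ` B = A" using bij_betw_inv_into[OF f] by (simp add: bij_betw_def)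
  ultimately show "\<exists>h. bilipschitz_embedding h B \<and> h ` B = A" by blast
qed

lemma bilipschitz_equivalentI:
  assumes g: "bilipschitz_embedding g A" and "g ` A = B"
  shows "bilipschitz_equivalent A B"
proof -
  obtain L where L: "L > 0" "\<And>x y. x \<in> A \<Longrightarrow> y \<in> A \<Longrightarrow> dist (g x) (g y) \<le> L * dist x y"
     "\<And>x y. x \<in> A \<Longrightarrow> y \<in> A \<Longrightarrow> dist x y \<le> L * dist (g x) (g y)"
    using g unfolding bilipschitz_embedding_def by blast
  have bij: "bij_betw g A B"
    using bilipschitz_embedding_inj_on[OF g] assms(2) by (simp add: bij_betw_def)
  have inv': "g (inv_into A g y) = y" "inv_into A g y \<in> A" if "y \<in> B" for y
    using bij that by (auto simp: bij_betw_def f_inv_into_f inv_into_into)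
  have "L-lipschitz_on A g" using L by (intro lipschitz_onI) auto
  moreover have "L-lipschitz_on B (inv_into A g)"
    using L(1) L(3) inv' by (intro lipschitz_onI) (metis less_imp_le)+
  ultimately show ?thesis using bij unfolding bilipschitz_equivalent_def by blast
qed

section \<open>Sets coded by symbol sequences\<close>

definition symbol_space :: "nat \<Rightarrow> (nat \<Rightarrow> nat) set" where
  "symbol_space m = {\<omega>. \<forall>k. \<omega> k < m}"

text \<open>Distances are comparable to \<open>\<rho> ^ k\<close> for the first disagreement \<open>k\<close> of the
  codes. The upper bound is demanded for every \<open>k\<close> below which the codes agree, so that for
  \<open>\<rho> < 1\<close> equal codes force equal points.\<close>

definition follows_code ::
    "real \<Rightarrow> ('i \<Rightarrow> nat \<Rightarrow> nat) \<Rightarrow> 'i set \<Rightarrow> ('i \<Rightarrow> 'a::metric_space) \<Rightarrow> bool" where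
  "follows_code \<rho> code I \<phi> \<longleftrightarrow>
     (\<exists>c>0. \<exists>C>0. \<forall>i\<in>I. \<forall>j\<in>I. \<forall>k. (\<forall>l<k. code i l = code j l) \<longrightarrow>
        dist (\<phi> i) (\<phi> j) \<le> C * \<rho> ^ k \<and> (code i k \<noteq> code j k \<longrightarrow> c * \<rho> ^ k \<le> dist (\<phi> i) (\<phi> j)))"

text \<open>The first disagreement of two codes determines both distances up to a
  constant factor. If there is none, both distances vanish.\<close>

lemma follows_code_comparable:
  assumes \<rho>: "0 < \<rho>" "\<rho> < 1"
    and "follows_code \<rho> code I \<phi>" "follows_code \<rho> code I \<psi>"
  shows "\<exists>L>0. \<forall>i\<in>I. \<forall>j\<in>I. dist (\<psi> i) (\<psi> j) \<le> L * dist (\<phi> i) (\<phi> j)"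
proof -
  obtain c where c: "c > 0" and lo: "\<And>i j k. i \<in> I \<Longrightarrow> j \<in> I \<Longrightarrow> \<forall>l<k. code i l = code j l \<Longrightarrow>
      code i k \<noteq> code j k \<Longrightarrow> c * \<rho> ^ k \<le> dist (\<phi> i) (\<phi> j)"
    using assms(3) unfolding follows_code_def by blast
  obtain C where C: "C > 0" and up: "\<And>i j k. i \<in> I \<Longrightarrow> j \<in> I \<Longrightarrow> \<forall>l<k. code i l = code j l \<Longrightarrow>
      dist (\<psi> i) (\<psi> j) \<le> C * \<rho> ^ k"
    using assms(4) unfolding follows_code_def by blast
  have "dist (\<psi> i) (\<psi> j) \<le> (C / c) * dist (\<phi> i) (\<phi> j)" if ij: "i \<in> I" "j \<in> I" for i j
  proof (cases "code i = code j")
    case True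
    have "(\<lambda>k. C * \<rho> ^ k) \<longlonglongrightarrow> C * 0"
      using \<rho> by (intro tendsto_mult_left LIMSEQ_realpow_zero) auto
    then have "dist (\<psi> i) (\<psi> j) \<le> C * 0"
      by (rule LIMSEQ_le_const) (use up ij True in auto)
    then show ?thesis using c C by (simp add: zero_le_mult_iff)
  next
    case False
    then have "\<exists>k. code i k \<noteq> code j k" by auto
    then obtain k where k: "code i k \<noteq> code j k" "\<forall>l<k. code i l = code j l"
      using exists_least_iff[of "\<lambda>k. code i k \<noteq> code j k"] by blast
    have "dist (\<psi> i) (\<psi> j) \<le> C * \<rho> ^ k" using up ij k by blast
    also have "\<dots> = (C / c) * (c * \<rho> ^ k)" using c by simp
    also have "\<dots> \<le> (C / c) * dist (\<phi> i) (\<phi> j)"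
      using lo[OF ij k(2,1)] c C by (intro mult_left_mono) auto
    finally show ?thesis .
  qed
  then show ?thesis using c C by (intro exI[of _ "C / c"]) auto
qed

lemma follows_code_bilipschitz_equivalent:
  assumes \<rho>: "0 < \<rho>" "\<rho> < 1"
    and \<phi>: "follows_code \<rho> code I \<phi>" and \<psi>: "follows_code \<rho> code I \<psi>"
  shows "bilipschitz_equivalent (\<phi> ` I) (\<psi> ` I)"
proof -
  obtain L where L: "L > 0" "\<And>i j. i \<in> I \<Longrightarrow> j \<in> I \<Longrightarrow> dist (\<psi> i) (\<psi> j) \<le> L * dist (\<phi> i) (\<phi> j)"
    using follows_code_comparable[OF \<rho> \<phi> \<psi>] by blast
  obtain M where M: "M > 0" "\<And>i j. i \<in> I \<Longrightarrow> j \<in> I \<Longrightarrow> dist (\<phi> i) (\<phi> j) \<le> M * dist (\<psi> i) (\<psi> j)"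
    using follows_code_comparable[OF \<rho> \<psi> \<phi>] by blast
  define h where "h x = inv_into I \<phi> x" for x
  have h: "h x \<in> I" "\<phi> (h x) = x" if "x \<in> \<phi> ` I" for x
    using that unfolding h_def by (auto intro: inv_into_into f_inv_into_f)
  \<comment> \<open>Points with the same image under \<open>\<phi>\<close> have the same image under \<open>\<psi>\<close>.\<close>
  have h\<psi>: "\<psi> (h (\<phi> i)) = \<psi> i" if "i \<in> I" for i
    using L(2)[of "h (\<phi> i)" i] h[of "\<phi> i"] that by auto
  have "dist (\<psi> (h x)) (\<psi> (h y)) \<le> max L M * dist x y \<and> dist x y \<le> max L M * dist (\<psi> (h x)) (\<psi> (h y))"
    if xy: "x \<in> \<phi> ` I" "y \<in> \<phi> ` I" for x y
  proof
    have "dist (\<psi> (h x)) (\<psi> (h y)) \<le> L * dist x y" using L(2)[of "h x" "h y"] h xy by auto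
    also have "\<dots> \<le> max L M * dist x y" by (intro mult_right_mono) auto
    finally show "dist (\<psi> (h x)) (\<psi> (h y)) \<le> max L M * dist x y" .
    have "dist x y \<le> M * dist (\<psi> (h x)) (\<psi> (h y))" using M(2)[of "h x" "h y"] h xy by auto
    also have "\<dots> \<le> max L M * dist (\<psi> (h x)) (\<psi> (h y))" by (intro mult_right_mono) auto
    finally show "dist x y \<le> max L M * dist (\<psi> (h x)) (\<psi> (h y))" .
  qed
  then have "bilipschitz_embedding (\<psi> \<circ> h) (\<phi> ` I)"
    unfolding bilipschitz_embedding_def using L(1) by (intro exI[of _ "max L M"]) auto
  moreover have "(\<psi> \<circ> h) ` \<phi> ` I = \<psi> ` I"
    using h\<psi> by (auto simp: image_iff)
  ultimately show ?thesis by (rule bilipschitz_equivalentI)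
qed

lemma compact_symbol_space: "compact (symbol_space m)"
proof -
  have "compactin (product_topology (\<lambda>_::nat. euclidean :: nat topology) UNIV) (PiE UNIV (\<lambda>_. {..<m}))"
    by (subst compactin_PiE) (auto intro: finite_imp_compact)
  moreover have "PiE UNIV (\<lambda>_. {..<m}) = symbol_space m" by (auto simp: symbol_space_def)
  ultimately show ?thesis by (simp add: euclidean_product_topology)
qed

text \<open>Agreement on the first \<open>k\<close> coordinates is an open condition in the product
  topology, so \<open>\<phi>\<close> is continuous on the compact sequence space.\<close>

lemma follows_code_compact:
  assumes \<rho>: "0 < \<rho>" "\<rho> < 1" and \<phi>: "follows_code \<rho> (\<lambda>\<omega>. \<omega>) (symbol_space m) \<phi>"
  shows "compact (\<phi> ` symbol_space m)"
proof -
  let ?S = "symbol_space m"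
  obtain C where C: "C > 0" and up: "\<And>\<omega> \<tau> k. \<omega> \<in> ?S \<Longrightarrow> \<tau> \<in> ?S \<Longrightarrow> \<forall>l<k. \<omega> l = \<tau> l \<Longrightarrow>
      dist (\<phi> \<omega>) (\<phi> \<tau>) \<le> C * \<rho> ^ k"
    using \<phi> unfolding follows_code_def by blast
  have "(\<phi> \<longlongrightarrow> \<phi> \<omega>) (at \<omega> within ?S)" if \<omega>: "\<omega> \<in> ?S" for \<omega>
  proof (rule tendstoI)
    fix e :: real assume e: "e > 0"
    have "(\<lambda>k. C * \<rho> ^ k) \<longlonglongrightarrow> C * 0"
      using \<rho> by (intro tendsto_mult_left LIMSEQ_realpow_zero) auto
    then have "\<forall>\<^sub>F k in sequentially. C * \<rho> ^ k < e"
      using e order_tendstoD(2)[of "\<lambda>k. C * \<rho> ^ k" "C * 0" sequentially e] by simp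
    then obtain k where k: "C * \<rho> ^ k < e"
      by (auto simp: eventually_sequentially)
    have "\<forall>\<^sub>F \<tau> in at \<omega> within ?S. \<tau> l = \<omega> l" for l
    proof -
      have "continuous_on UNIV (\<lambda>\<tau>::nat\<Rightarrow>nat. \<tau> l)" by (rule continuous_on_product_coordinates)
      then have "((\<lambda>\<tau>::nat\<Rightarrow>nat. \<tau> l) \<longlongrightarrow> \<omega> l) (at \<omega>)" by (auto simp: continuous_on_def)
      then have "((\<lambda>\<tau>::nat\<Rightarrow>nat. \<tau> l) \<longlongrightarrow> \<omega> l) (at \<omega> within ?S)"
        by (rule tendsto_within_subset) auto
      then show ?thesis by (simp add: tendsto_discrete)
    qed
    then have "\<forall>\<^sub>F \<tau> in at \<omega> within ?S. \<forall>l\<in>{..<k}. \<tau> l = \<omega> l"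
      by (intro eventually_ball_finite) auto
    moreover have "\<forall>\<^sub>F \<tau> in at \<omega> within ?S. \<tau> \<in> ?S"
      by (simp add: eventually_at_filter)
    ultimately show "\<forall>\<^sub>F \<tau> in at \<omega> within ?S. dist (\<phi> \<tau>) (\<phi> \<omega>) < e"
    proof eventually_elim
      case (elim \<tau>)
      then have "dist (\<phi> \<tau>) (\<phi> \<omega>) \<le> C * \<rho> ^ k" using \<omega> by (intro up) auto
      then show ?case using k by simp
    qed
  qed
  then have "continuous_on ?S \<phi>" by (auto simp: continuous_on_def)
  then show ?thesis by (intro compact_continuous_image compact_symbol_space)
qed

primrec walk :: "(nat \<Rightarrow> 'a \<Rightarrow> nat \<Rightarrow> 'a) \<Rightarrow> 'a \<Rightarrow> (nat \<Rightarrow> nat) \<Rightarrow> nat \<Rightarrow> 'a" where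
  "walk g x \<omega> 0 = x"
| "walk g x \<omega> (Suc k) = g k (walk g x \<omega> k) (\<omega> k)"

text \<open>The walks converge, since their steps are at most \<open>R * \<rho> ^ k\<close>. At the
  first disagreement of two sequences the walks move apart by \<open>\<kappa> * R * \<rho> ^ k\<close>; the rest of either
  walk has length at most \<open>8 / 7 * R * \<rho> ^ (k + 1)\<close>, where \<open>8 / 7\<close> bounds \<open>1 / (1 - \<rho>)\<close>, and by
  \<open>8 * \<rho> \<le> \<kappa>\<close> both rests together are too short to close the gap.\<close>

lemma separated_choices_give_coded_set:
  fixes E :: "'a::complete_space set"
  assumes \<rho>: "0 < \<rho>" "8 * \<rho> \<le> \<kappa>" "\<kappa> \<le> 1" and R: "R > 0" and x0: "x0 \<in> E"
    and g: "\<And>k x i. x \<in> E \<Longrightarrow> i < m \<Longrightarrow> g k x i \<in> E \<and> dist x (g k x i) \<le> R * \<rho> ^ k"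
    and sep: "\<And>k x i j. x \<in> E \<Longrightarrow> i < m \<Longrightarrow> j < m \<Longrightarrow> i \<noteq> j \<Longrightarrow> \<kappa> * (R * \<rho> ^ k) \<le> dist (g k x i) (g k x j)"
  shows "\<exists>\<phi>. follows_code \<rho> (\<lambda>\<omega>. \<omega>) (symbol_space m) \<phi> \<and> \<phi> ` symbol_space m \<subseteq> closure E"
proof -
  let ?S = "symbol_space m"
  let ?w = "walk g x0"
  have in_E: "?w \<omega> k \<in> E" if "\<omega> \<in> ?S" for \<omega> k
    using that by (induction k) (auto simp: x0 g symbol_space_def)
  have tail: "dist (?w \<omega> k) (?w \<omega> (k + d)) \<le> 8 / 7 * R * (\<rho> ^ k - \<rho> ^ (k + d))" if \<omega>: "\<omega> \<in> ?S" for \<omega> k d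
  proof (induction d)
    case (Suc d)
    have "dist (?w \<omega> (k + d)) (?w \<omega> (k + Suc d)) \<le> R * \<rho> ^ (k + d)"
      using g[OF in_E[OF \<omega>]] \<omega> by (auto simp: symbol_space_def)
    also have "\<dots> \<le> 8 / 7 * R * (\<rho> ^ (k + d) * (1 - \<rho>))"
    proof -
      have "R * \<rho> ^ (k + d) * 1 \<le> R * \<rho> ^ (k + d) * (8 / 7 * (1 - \<rho>))"
        using \<rho> R by (intro mult_left_mono) auto
      then show ?thesis by (simp add: algebra_simps)
    qed
    finally have "dist (?w \<omega> (k + d)) (?w \<omega> (k + Suc d)) \<le> 8 / 7 * R * (\<rho> ^ (k + d) - \<rho> ^ (k + Suc d))"
      by (simp add: algebra_simps)
    with Suc.IH show ?case
      using dist_triangle[of "?w \<omega> k" "?w \<omega> (k + Suc d)" "?w \<omega> (k + d)"]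
      by (simp add: algebra_simps)
  qed simp
  have tail': "dist (?w \<omega> k) (?w \<omega> n) \<le> 8 / 7 * R * \<rho> ^ k" if "\<omega> \<in> ?S" "k \<le> n" for \<omega> k n
  proof -
    have "dist (?w \<omega> k) (?w \<omega> n) \<le> 8 / 7 * R * (\<rho> ^ k - \<rho> ^ n)"
      using tail[OF that(1), of k "n - k"] that(2) by simp
    also have "\<dots> \<le> 8 / 7 * R * \<rho> ^ k" using \<rho> R by (intro mult_left_mono) auto
    finally show ?thesis .
  qed
  define \<phi> where "\<phi> \<omega> = lim (?w \<omega>)" for \<omega>
  have lim: "?w \<omega> \<longlonglongrightarrow> \<phi> \<omega>" if \<omega>: "\<omega> \<in> ?S" for \<omega>
  proof -
    have "Cauchy (?w \<omega>)"
    proof (rule metric_CauchyI)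
      fix e :: real assume e: "e > 0"
      have "(\<lambda>k. 16 / 7 * R * \<rho> ^ k) \<longlonglongrightarrow> 16 / 7 * R * 0"
        using \<rho> by (intro tendsto_mult_left LIMSEQ_realpow_zero) auto
      then have "\<forall>\<^sub>F k in sequentially. 16 / 7 * R * \<rho> ^ k < e"
        using e order_tendstoD(2)[of "\<lambda>k. 16 / 7 * R * \<rho> ^ k" "16 / 7 * R * 0" sequentially e] by simp
      then obtain k where k: "16 / 7 * R * \<rho> ^ k < e"
        by (auto simp: eventually_sequentially)
      have "dist (?w \<omega> a) (?w \<omega> b) < e" if "a \<ge> k" "b \<ge> k" for a b
      proof -
        have "dist (?w \<omega> a) (?w \<omega> b) \<le> dist (?w \<omega> k) (?w \<omega> a) + dist (?w \<omega> k) (?w \<omega> b)"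
          by (metis dist_commute dist_triangle)
        then show ?thesis using tail'[OF \<omega> that(1)] tail'[OF \<omega> that(2)] k by simp
      qed
      then show "\<exists>M. \<forall>m\<ge>M. \<forall>n\<ge>M. dist (?w \<omega> m) (?w \<omega> n) < e" by blast
    qed
    then show ?thesis unfolding \<phi>_def by (simp add: Cauchy_convergent_iff convergent_LIMSEQ_iff)
  qed
  have near: "dist (?w \<omega> k) (\<phi> \<omega>) \<le> 8 / 7 * R * \<rho> ^ k" if \<omega>: "\<omega> \<in> ?S" for \<omega> k
    by (rule LIMSEQ_le_const2[OF tendsto_dist[OF tendsto_const lim[OF \<omega>]]])
       (use tail'[OF \<omega>] in blast)
  have same: "?w \<omega> k = ?w \<tau> k" if "\<forall>l<k. \<omega> l = \<tau> l" for \<omega> \<tau> k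
    using that by (induction k) auto
  have up: "dist (\<phi> \<omega>) (\<phi> \<tau>) \<le> 16 / 7 * R * \<rho> ^ k" if "\<omega> \<in> ?S" "\<tau> \<in> ?S" "\<forall>l<k. \<omega> l = \<tau> l" for \<omega> \<tau> k
  proof -
    have "dist (\<phi> \<omega>) (\<phi> \<tau>) \<le> dist (?w \<omega> k) (\<phi> \<omega>) + dist (?w \<omega> k) (\<phi> \<tau>)"
      by (metis dist_commute dist_triangle)
    then show ?thesis using near[OF that(1), of k] near[OF that(2), of k] same[OF that(3)] by simp
  qed
  have lo: "5 / 7 * \<kappa> * R * \<rho> ^ k \<le> dist (\<phi> \<omega>) (\<phi> \<tau>)"
    if \<omega>\<tau>: "\<omega> \<in> ?S" "\<tau> \<in> ?S" "\<forall>l<k. \<omega> l = \<tau> l" "\<omega> k \<noteq> \<tau> k" for \<omega> \<tau> k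
  proof -
    have "\<kappa> * (R * \<rho> ^ k) \<le> dist (?w \<omega> (Suc k)) (?w \<tau> (Suc k))"
      using sep[OF in_E[OF \<omega>\<tau>(1)], of "\<omega> k" "\<tau> k" k k] \<omega>\<tau> same[OF \<omega>\<tau>(3)] by (simp add: symbol_space_def)
    also have "\<dots> \<le> dist (?w \<omega> (Suc k)) (\<phi> \<omega>) + dist (\<phi> \<omega>) (\<phi> \<tau>) + dist (?w \<tau> (Suc k)) (\<phi> \<tau>)"
      using dist_triangle[of "?w \<omega> (Suc k)" "?w \<tau> (Suc k)" "\<phi> \<omega>"]
        dist_triangle[of "\<phi> \<omega>" "?w \<tau> (Suc k)" "\<phi> \<tau>"] by (simp add: dist_commute)
    also have "\<dots> \<le> dist (\<phi> \<omega>) (\<phi> \<tau>) + 16 / 7 * R * \<rho> ^ Suc k"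
      using near[OF \<omega>\<tau>(1), of "Suc k"] near[OF \<omega>\<tau>(2), of "Suc k"] by simp
    also have "16 / 7 * R * \<rho> ^ Suc k \<le> 2 / 7 * \<kappa> * R * \<rho> ^ k"
    proof -
      have "2 / 7 * R * \<rho> ^ k * (8 * \<rho>) \<le> 2 / 7 * R * \<rho> ^ k * \<kappa>"
        using \<rho> R by (intro mult_left_mono) auto
      then show ?thesis by (simp add: mult_ac)
    qed
    finally show ?thesis by (simp add: algebra_simps)
  qed
  have "follows_code \<rho> (\<lambda>\<omega>. \<omega>) ?S \<phi>"
    unfolding follows_code_def
    apply (rule exI[of _ "5 / 7 * \<kappa> * R"], rule conjI)
    using \<rho> R apply simp
    apply (rule exI[of _ "16 / 7 * R"], rule conjI)
    using R apply simp
    using up lo by blast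
  moreover have "\<phi> \<omega> \<in> closure E" if "\<omega> \<in> ?S" for \<omega>
    using lim[OF that] in_E[OF that] closure_sequential by blast
  ultimately show ?thesis by blast
qed

section \<open>Homogeneous self-similar sets with strong separation\<close>

lemma similarity_dimension_homogeneous:
  assumes "m > 0" "0 < \<rho>" "\<rho> < 1" "\<And>i. i < m \<Longrightarrow> r i = \<rho>"
  shows "similarity_dimension m r = ln (real m) / ln (1 / \<rho>)"
proof -
  have eq: "(\<Sum>i<m. r i powr s) = real m * \<rho> powr s" for s
    using assms(4) by simp
  have "(\<Sum>i<m. r i powr s) = 1 \<longleftrightarrow> s = ln (real m) / ln (1 / \<rho>)" for s
  proof -
    have "real m * \<rho> powr s = 1 \<longleftrightarrow> ln (real m * \<rho> powr s) = ln 1"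
      using assms by (subst ln_inj_iff) auto
    also have "\<dots> \<longleftrightarrow> ln (real m) + s * ln \<rho> = 0"
      using assms by (simp add: ln_mult ln_powr)
    also have "\<dots> \<longleftrightarrow> s = ln (real m) / ln (1 / \<rho>)"
      using assms by (auto simp: ln_div field_simps)
    finally show ?thesis using eq by simp
  qed
  then show ?thesis unfolding similarity_dimension_def by simp
qed

lemma homogeneous_normal_form:
  assumes "self_similar_by m f r S" "homogeneous_ratios m r"
  obtains \<rho> where "self_similar_by m f (\<lambda>_. \<rho>) S" "0 < \<rho>" "\<rho> < 1" "m > 0"
    "similarity_dimension m r = ln (real m) / ln (1 / \<rho>)"
proof -
  have m: "m > 0" using assms(1) unfolding self_similar_by_def by (cases m) auto
  have r: "r i = r 0" if "i < m" for i
    using assms(2) m that unfolding homogeneous_ratios_def by blast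
  have 1: "self_similar_by m f (\<lambda>_. r 0) S"
    using assms(1) r unfolding self_similar_by_def by metis
  have 2: "0 < r 0" "r 0 < 1"
    using assms(1) m unfolding self_similar_by_def contracting_similarity_def by blast+
  show ?thesis
    using that[OF 1 2 m similarity_dimension_homogeneous[OF m 2 r]] by blast
qed

text \<open>The limit of \<open>f (\<omega> 0) \<circ> f (\<omega> 1) \<circ> \<dots>\<close> for the maps \<open>f i x = p i + \<rho> *\<^sub>R x\<close>.\<close>

definition address_point :: "real \<Rightarrow> (nat \<Rightarrow> 'a::banach) \<Rightarrow> (nat \<Rightarrow> nat) \<Rightarrow> 'a" where
  "address_point \<rho> p \<omega> = (\<Sum>k. \<rho> ^ k *\<^sub>R p (\<omega> k))"

lemma
  fixes p :: "nat \<Rightarrow> 'a::banach"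
  assumes \<rho>: "0 < \<rho>" "\<rho> < 1" and p: "\<And>i. i < m \<Longrightarrow> norm (p i) \<le> 1" and \<omega>: "\<omega> \<in> symbol_space m"
  shows address_point_shift: "address_point \<rho> p \<omega> = p (\<omega> 0) + \<rho> *\<^sub>R address_point \<rho> p (\<lambda>k. \<omega> (Suc k))"
    and norm_address_point: "norm (address_point \<rho> p \<omega>) \<le> 1 / (1 - \<rho>)"
proof -
  have le: "norm (\<rho> ^ k *\<^sub>R p (\<sigma> k)) \<le> \<rho> ^ k" if "\<sigma> \<in> symbol_space m" for \<sigma> k
    using p[of "\<sigma> k"] that \<rho> by (simp add: symbol_space_def mult_left_le)
  have geo: "summable (\<lambda>k. \<rho> ^ k)" using \<rho> by (intro summable_geometric) auto
  have summ: "summable (\<lambda>k. norm (\<rho> ^ k *\<^sub>R p (\<sigma> k)))" if "\<sigma> \<in> symbol_space m" for \<sigma>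
    using geo le[OF that] by (intro summable_comparison_test'[OF geo, of 0]) auto
  have shift: "(\<lambda>k. \<omega> (Suc k)) \<in> symbol_space m" using \<omega> by (simp add: symbol_space_def)
  have "address_point \<rho> p \<omega> = (\<Sum>k. \<rho> ^ Suc k *\<^sub>R p (\<omega> (Suc k))) + p (\<omega> 0)"
    using suminf_split_head[OF summable_norm_cancel[OF summ[OF \<omega>]]]
    by (simp add: address_point_def)
  also have "(\<Sum>k. \<rho> ^ Suc k *\<^sub>R p (\<omega> (Suc k))) = \<rho> *\<^sub>R (\<Sum>k. \<rho> ^ k *\<^sub>R p (\<omega> (Suc k)))"
    using suminf_scaleR_right[OF summable_norm_cancel[OF summ[OF shift]], of \<rho>] by simp
  finally show "address_point \<rho> p \<omega> = p (\<omega> 0) + \<rho> *\<^sub>R address_point \<rho> p (\<lambda>k. \<omega> (Suc k))"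
    by (simp add: address_point_def)
  have "norm (address_point \<rho> p \<omega>) \<le> (\<Sum>k. norm (\<rho> ^ k *\<^sub>R p (\<omega> k)))"
    unfolding address_point_def by (rule summable_norm[OF summ[OF \<omega>]])
  also have "\<dots> \<le> (\<Sum>k. \<rho> ^ k)" by (rule suminf_le[OF le[OF \<omega>] summ[OF \<omega>] geo])
  also have "\<dots> = 1 / (1 - \<rho>)" using \<rho> by (intro suminf_geometric) auto
  finally show "norm (address_point \<rho> p \<omega>) \<le> 1 / (1 - \<rho>)" .
qed

text \<open>Dropping a common first symbol divides distances by \<open>\<rho>\<close>, which reduces the
  claim to \<open>k = 0\<close>. There the points \<open>p i\<close> differ by at least \<open>\<kappa>\<close>, while the two tails contribute
  at most \<open>\<rho> * 16 / 7 \<le> 2 / 7 * \<kappa>\<close>.\<close>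

lemma address_point_follows_code:
  fixes p :: "nat \<Rightarrow> 'a::banach"
  assumes \<rho>: "0 < \<rho>" "8 * \<rho> \<le> \<kappa>" "\<kappa> \<le> 1" and p: "\<And>i. i < m \<Longrightarrow> norm (p i) \<le> 1"
    and sep: "\<And>i j. i < m \<Longrightarrow> j < m \<Longrightarrow> i \<noteq> j \<Longrightarrow> \<kappa> \<le> dist (p i) (p j)"
  shows "follows_code \<rho> (\<lambda>\<omega>. \<omega>) (symbol_space m) (address_point \<rho> p)"
proof -
  let ?S = "symbol_space m" and ?a = "address_point \<rho> p"
  have \<rho>1: "\<rho> < 1" using \<rho> by simp
  have bound: "norm (?a \<omega>) \<le> 8 / 7" if "\<omega> \<in> ?S" for \<omega>
  proof -
    have "1 / (1 - \<rho>) \<le> 8 / 7" using \<rho> by (simp add: field_simps)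
    then show ?thesis using norm_address_point[where p = p, OF \<rho>(1) \<rho>1 p that] by simp
  qed
  have diam: "dist (?a \<omega>) (?a \<tau>) \<le> 16 / 7" if "\<omega> \<in> ?S" "\<tau> \<in> ?S" for \<omega> \<tau>
    using norm_triangle_ineq4[of "?a \<omega>" "?a \<tau>"] bound[OF that(1)] bound[OF that(2)] by (simp add: dist_norm)
  have shift: "(\<lambda>k. \<omega> (Suc k)) \<in> ?S" if "\<omega> \<in> ?S" for \<omega> using that by (simp add: symbol_space_def)
  have main: "dist (?a \<omega>) (?a \<tau>) \<le> 16 / 7 * \<rho> ^ k \<and>
      (\<omega> k \<noteq> \<tau> k \<longrightarrow> 5 / 7 * \<kappa> * \<rho> ^ k \<le> dist (?a \<omega>) (?a \<tau>))"
    if "\<omega> \<in> ?S" "\<tau> \<in> ?S" "\<forall>l<k. \<omega> l = \<tau> l" for \<omega> \<tau> k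
    using that
  proof (induction k arbitrary: \<omega> \<tau>)
    case 0
    let ?u = "?a (\<lambda>k. \<omega> (Suc k))" and ?v = "?a (\<lambda>k. \<tau> (Suc k))"
    have eq: "p (\<omega> 0) - p (\<tau> 0) = (?a \<omega> - ?a \<tau>) - \<rho> *\<^sub>R (?u - ?v)"
      using address_point_shift[where p = p, OF \<rho>(1) \<rho>1 p 0(1)] address_point_shift[where p = p, OF \<rho>(1) \<rho>1 p 0(2)]
      by (simp add: algebra_simps)
    have "dist (p (\<omega> 0)) (p (\<tau> 0)) \<le> dist (?a \<omega>) (?a \<tau>) + \<rho> * dist ?u ?v"
      using norm_triangle_ineq4[of "?a \<omega> - ?a \<tau>" "\<rho> *\<^sub>R (?u - ?v)"] \<rho> unfolding dist_norm eq by simp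
    also have "\<rho> * dist ?u ?v \<le> \<kappa> / 8 * (16 / 7)"
      using diam[OF shift[OF 0(1)] shift[OF 0(2)]] \<rho> by (intro mult_mono) auto
    finally have "\<omega> 0 \<noteq> \<tau> 0 \<longrightarrow> 5 / 7 * \<kappa> \<le> dist (?a \<omega>) (?a \<tau>)"
      using sep[of "\<omega> 0" "\<tau> 0"] 0 by (auto simp: symbol_space_def)
    then show ?case using diam[OF 0(1,2)] by simp
  next
    case (Suc k)
    let ?u = "?a (\<lambda>k. \<omega> (Suc k))" and ?v = "?a (\<lambda>k. \<tau> (Suc k))"
    have "?a \<omega> - ?a \<tau> = \<rho> *\<^sub>R (?u - ?v)"
      using address_point_shift[where p = p, OF \<rho>(1) \<rho>1 p Suc.prems(1)] address_point_shift[where p = p, OF \<rho>(1) \<rho>1 p Suc.prems(2)]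
        Suc.prems(3) by (simp add: algebra_simps)
    then have eq: "dist (?a \<omega>) (?a \<tau>) = \<rho> * dist ?u ?v" using \<rho> by (simp add: dist_norm)
    have "dist ?u ?v \<le> 16 / 7 * \<rho> ^ k \<and>
      (\<omega> (Suc k) \<noteq> \<tau> (Suc k) \<longrightarrow> 5 / 7 * \<kappa> * \<rho> ^ k \<le> dist ?u ?v)"
      using Suc.IH[OF shift[OF Suc.prems(1)] shift[OF Suc.prems(2)]] Suc.prems(3) by auto
    then show ?case unfolding eq using \<rho>
      by (auto simp: mult.left_commute intro: mult_left_mono)
  qed
  show ?thesis
    unfolding follows_code_def
    apply (rule exI[of _ "5 / 7 * \<kappa>"], rule conjI)
    using \<rho> apply simp
    apply (rule exI[of _ "16 / 7"], rule conjI)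
     apply simp
    using main by blast
qed

text \<open>The image of the set under \<open>f i\<close> consists of the points whose address
  starts with \<open>i\<close>, and points with different first symbols are apart.\<close>

lemma address_points_self_similar:
  fixes p :: "nat \<Rightarrow> 'a::banach"
  assumes \<rho>: "0 < \<rho>" "8 * \<rho> \<le> \<kappa>" "\<kappa> \<le> 1" and m: "m > 0" and p: "\<And>i. i < m \<Longrightarrow> norm (p i) \<le> 1"
    and sep: "\<And>i j. i < m \<Longrightarrow> j < m \<Longrightarrow> i \<noteq> j \<Longrightarrow> \<kappa> \<le> dist (p i) (p j)"
  defines "f \<equiv> \<lambda>i x. p i + \<rho> *\<^sub>R x" and "S \<equiv> address_point \<rho> p ` symbol_space m"
  shows "self_similar_by m f (\<lambda>_. \<rho>) S" "strong_separation m f S"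
proof -
  let ?S = "symbol_space m" and ?a = "address_point \<rho> p"
  have \<rho>1: "\<rho> < 1" using \<rho> by simp
  have fc: "follows_code \<rho> (\<lambda>\<omega>. \<omega>) ?S ?a"
    by (rule address_point_follows_code[where p = p, OF \<rho> p sep])
  have compact: "compact S"
    unfolding S_def by (rule follows_code_compact[OF \<rho>(1) \<rho>1 fc])
  have ne: "S \<noteq> {}" unfolding S_def symbol_space_def using m by auto
  have cons: "case_nat i \<omega> \<in> ?S \<and> f i (?a \<omega>) = ?a (case_nat i \<omega>)" if "i < m" "\<omega> \<in> ?S" for i \<omega>
  proof -
    have "case_nat i \<omega> \<in> ?S" using that by (auto simp: symbol_space_def split: nat.split)
    then show ?thesis
      using address_point_shift[of \<rho> m p "case_nat i \<omega>", OF \<rho>(1) \<rho>1 p] unfolding f_def by simp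
  qed
  have "S = (\<Union>i<m. f i ` S)"
  proof
    show "S \<subseteq> (\<Union>i<m. f i ` S)"
    proof
      fix x assume "x \<in> S"
      then obtain \<omega> where \<omega>: "\<omega> \<in> ?S" "x = ?a \<omega>" unfolding S_def by auto
      have "(\<lambda>k. \<omega> (Suc k)) \<in> ?S" "\<omega> 0 < m" using \<omega> by (auto simp: symbol_space_def)
      then show "x \<in> (\<Union>i<m. f i ` S)"
        using address_point_shift[where p = p, OF \<rho>(1) \<rho>1 p \<omega>(1)] \<omega>(2) unfolding S_def f_def by auto
    qed
    show "(\<Union>i<m. f i ` S) \<subseteq> S" using cons unfolding S_def by auto
  qed
  moreover have "contracting_similarity \<rho> (f i)" for i
    using \<rho> \<rho>1 unfolding contracting_similarity_def f_def
    by (simp add: dist_norm flip: scaleR_diff_right)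
  ultimately show "self_similar_by m f (\<lambda>_. \<rho>) S"
    using compact ne unfolding self_similar_by_def by blast
  obtain c where c: "c > 0" and lo: "\<And>\<omega> \<tau>. \<omega> \<in> ?S \<Longrightarrow> \<tau> \<in> ?S \<Longrightarrow> \<omega> 0 \<noteq> \<tau> 0 \<Longrightarrow> c \<le> dist (?a \<omega>) (?a \<tau>)"
  proof -
    obtain c where "c > 0" "\<And>\<omega> \<tau> k. \<omega> \<in> ?S \<Longrightarrow> \<tau> \<in> ?S \<Longrightarrow> (\<forall>l<k. \<omega> l = \<tau> l) \<Longrightarrow> \<omega> k \<noteq> \<tau> k \<Longrightarrow> c * \<rho> ^ k \<le> dist (?a \<omega>) (?a \<tau>)"
      using fc unfolding follows_code_def by blast
    from this(1) this(2)[where k = 0] that show ?thesis by simp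
  qed
  show "strong_separation m f S"
    unfolding strong_separation_def
  proof (intro allI impI equals0I)
    fix i j x assume ij: "i < m" "j < m" "i \<noteq> j" and "x \<in> f i ` S \<inter> f j ` S"
    then obtain \<omega> \<tau> where \<omega>\<tau>: "\<omega> \<in> ?S" "\<tau> \<in> ?S" "x = f i (?a \<omega>)" "x = f j (?a \<tau>)"
      unfolding S_def by auto
    then have "c \<le> dist x x"
      using lo[of "case_nat i \<omega>" "case_nat j \<tau>"] cons ij by auto
    then show False using c by simp
  qed
qed

section \<open>The dimension of a coded set\<close>

lemma
  fixes D :: "'a::euclidean_space set \<Rightarrow> real"
  assumes "dimension_like D"
  shows dimension_like_nonneg: "compact K \<Longrightarrow> 0 \<le> D K"
    and dimension_like_le_DIM: "compact K \<Longrightarrow> D K \<le> real DIM('a)"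
    and dimension_like_cong:
      "compact A \<Longrightarrow> compact B \<Longrightarrow> bilipschitz_equivalent A B \<Longrightarrow> D A = D B"
    and dimension_like_mono: "compact A \<Longrightarrow> compact B \<Longrightarrow> A \<subseteq> B \<Longrightarrow> D A \<le> D B"
    and dimension_like_self_similar:
      "self_similar_by m f r S \<Longrightarrow> homogeneous_ratios m r \<Longrightarrow> strong_separation m f S \<Longrightarrow>
        D S = similarity_dimension m r"
proof -
  note D = assms[unfolded dimension_like_def]
  show "compact K \<Longrightarrow> 0 \<le> D K" and "compact K \<Longrightarrow> D K \<le> real DIM('a)"
    using D[THEN conjunct1] by blast+
  show "compact A \<Longrightarrow> compact B \<Longrightarrow> bilipschitz_equivalent A B \<Longrightarrow> D A = D B"
    using D[THEN conjunct2, THEN conjunct1] by blast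
  show "compact A \<Longrightarrow> compact B \<Longrightarrow> A \<subseteq> B \<Longrightarrow> D A \<le> D B"
    using D[THEN conjunct2, THEN conjunct2, THEN conjunct1] by blast
  show "self_similar_by m f r S \<Longrightarrow> homogeneous_ratios m r \<Longrightarrow> strong_separation m f S \<Longrightarrow>
        D S = similarity_dimension m r"
    by (rule D[THEN conjunct2, THEN conjunct2, THEN conjunct2, rule_format]) (intro conjI)
qed

lemma coded_set_dimension:
  fixes D :: "'a::euclidean_space set \<Rightarrow> real"
  assumes D: "dimension_like D"
    and \<rho>: "0 < \<rho>" "8 * \<rho> \<le> \<kappa>" "\<kappa> \<le> 1" and m: "m > 0" and p: "\<And>i. i < m \<Longrightarrow> norm (p i :: 'a) \<le> 1"
    and sep: "\<And>i j. i < m \<Longrightarrow> j < m \<Longrightarrow> i \<noteq> j \<Longrightarrow> \<kappa> \<le> dist (p i) (p j)"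
  shows "D (address_point \<rho> p ` symbol_space m) = ln (real m) / ln (1 / \<rho>)"
    "compact (address_point \<rho> p ` symbol_space m)"
proof -
  let ?T = "address_point \<rho> p ` symbol_space m"
  note ss = address_points_self_similar[where p = p, OF \<rho> m p sep]
  show "compact ?T" using ss(1) unfolding self_similar_by_def by blast
  have "D ?T = similarity_dimension m (\<lambda>_. \<rho>)"
    using dimension_like_self_similar[OF D ss(1) _ ss(2)] by (simp add: homogeneous_ratios_def)
  also have "\<dots> = ln (real m) / ln (1 / \<rho>)"
    using m \<rho> by (intro similarity_dimension_homogeneous) auto
  finally show "D ?T = ln (real m) / ln (1 / \<rho>)" .
qed

section \<open>Covering numbers and separated sets\<close>

definition separated_by :: "real \<Rightarrow> 'a::metric_space set \<Rightarrow> bool" where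
  "separated_by r P \<longleftrightarrow> (\<forall>x\<in>P. \<forall>y\<in>P. x \<noteq> y \<longrightarrow> r < dist x y)"

lemma separated_by_subset: "separated_by r P \<Longrightarrow> Q \<subseteq> P \<Longrightarrow> separated_by r Q"
  unfolding separated_by_def by blast

lemma covering_number_le_card:
  "finite F \<Longrightarrow> X \<subseteq> (\<Union>c\<in>F. cball c r) \<Longrightarrow> covering_number X r \<le> card F"
  unfolding covering_number_def by (rule Least_le) blast

text \<open>A ball of radius \<open>r\<close> contains at most one point of a set whose points are more than
  \<open>2 * r\<close> apart. Boundedness makes the minimum in the covering number range over a nonempty set.\<close>

lemma card_separated_le_covering_number:
  fixes X :: "'a::heine_borel set"
  assumes P: "separated_by (2 * r) P" "P \<subseteq> X" and X: "bounded X" and r: "r > 0"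
  shows "card P \<le> covering_number X r"
proof -
  have "compact (closure X)" using X by (simp add: compact_closure)
  then have "\<forall>e>0. \<exists>F. finite F \<and> F \<subseteq> closure X \<and> closure X \<subseteq> (\<Union>c\<in>F. ball c e)"
    by (intro seq_compact_imp_totally_bounded compact_imp_seq_compact)
  then obtain F where F0: "finite F" "closure X \<subseteq> (\<Union>c\<in>F. ball c r)"
    using r by (elim allE[of _ r]) auto
  have "X \<subseteq> (\<Union>c\<in>F. cball c r)"
  proof
    fix x assume "x \<in> X"
    then have "x \<in> (\<Union>c\<in>F. ball c r)" using closure_subset F0(2) by (meson subsetD)
    then show "x \<in> (\<Union>c\<in>F. cball c r)" using ball_subset_cball by (meson UN_E UN_I subsetD)
  qed
  with F0(1) have "\<exists>k F. finite F \<and> card F = k \<and> X \<subseteq> (\<Union>c\<in>F. cball c r)" by auto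
  then have "\<exists>F. finite F \<and> card F = covering_number X r \<and> X \<subseteq> (\<Union>c\<in>F. cball c r)"
    unfolding covering_number_def by (rule LeastI_ex)
  then obtain F where F: "finite F" "card F = covering_number X r" "X \<subseteq> (\<Union>c\<in>F. cball c r)"
    by blast
  have "\<forall>x\<in>P. \<exists>c\<in>F. dist c x \<le> r" using F(3) P(2) by fastforce
  then obtain h where h: "\<And>x. x \<in> P \<Longrightarrow> h x \<in> F \<and> dist (h x) x \<le> r" by metis
  have "inj_on h P"
  proof (rule inj_onI, rule ccontr)
    fix x y assume xy: "x \<in> P" "y \<in> P" "h x = h y" "x \<noteq> y"
    have "dist x y \<le> dist (h x) x + dist (h x) y" by (metis dist_commute dist_triangle)
    then show False using P(1) h[of x] h[of y] xy unfolding separated_by_def by fastforce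
  qed
  then show ?thesis using h F(1,2) card_inj_on_le[of h P F] by auto
qed

text \<open>The balls of radius \<open>r\<close> around a maximal set of points more than \<open>r\<close> apart cover
  \<open>X\<close>, so such a set cannot be smaller than the covering number.\<close>

lemma separated_subset_of_size_covering_number:
  assumes m: "m \<le> covering_number X r" and r: "r \<ge> 0"
  shows "\<exists>P\<subseteq>X. finite P \<and> card P = m \<and> separated_by r P"
proof (rule ccontr)
  assume no: "\<not> ?thesis"
  let ?ok = "\<lambda>P. P \<subseteq> X \<and> finite P \<and> separated_by r P"
  have small: "card P < m" if P: "?ok P" for P
  proof (rule ccontr)
    assume "\<not> card P < m"
    then obtain Q where "Q \<subseteq> P" "card Q = m" "finite Q"
      by (metis not_less obtain_subset_with_card_n)
    then show False using no P separated_by_subset[of r P Q] by blast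
  qed
  have "?ok {}" by (simp add: separated_by_def)
  then obtain P where P: "?ok P" and max: "\<And>Q. ?ok Q \<Longrightarrow> card Q \<le> card P"
    using ex_has_greatest_nat[of ?ok "{}" card m] small less_imp_le by metis
  have "X \<subseteq> (\<Union>c\<in>P. cball c r)"
  proof (rule ccontr)
    assume "\<not> X \<subseteq> (\<Union>c\<in>P. cball c r)"
    then obtain y where y: "y \<in> X" "\<And>c. c \<in> P \<Longrightarrow> r < dist c y" by (auto, metis not_le)
    then have "y \<notin> P" using r by force
    moreover have "?ok (insert y P)"
      using P y by (auto simp: separated_by_def dist_commute)
    ultimately show False using max[of "insert y P"] P by simp
  qed
  then have "covering_number X r \<le> card P" using P by (intro covering_number_le_card) auto
  then show False using small[OF P] m by simp
qed

section \<open>The lower bound\<close>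

text \<open>If \<open>D K = d < \<alpha>\<close>, a small enough scale \<open>\<kappa> = exp (- t)\<close> leads to a coded set in \<open>K\<close>
  whose dimension \<open>ln m / (ln 8 + t)\<close>, with \<open>ln m \<ge> ln C + \<alpha> * t\<close>, exceeds \<open>d\<close>.\<close>

lemma lower_exponent_le:
  fixes D :: "'a::euclidean_space set \<Rightarrow> real"
  assumes D: "dimension_like D" and K: "compact K" and E: "E \<subseteq> K" and R0: "0 < R0"
    and C: "C > 0" and x0: "x0 \<in> E"
    and thick: "\<And>x r R. x \<in> E \<Longrightarrow> 0 < r \<Longrightarrow> r < R \<Longrightarrow> R \<le> R0 \<Longrightarrow>
       C * (R / r) powr \<alpha> \<le> real (covering_number (cball x R \<inter> E) r)"
  shows "\<alpha> \<le> D K"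
proof (rule ccontr)
  define d where "d = D K"
  assume "\<not> \<alpha> \<le> D K"
  then have \<alpha>: "d < \<alpha>" by (simp add: d_def)
  have d0: "0 \<le> d" using dimension_like_nonneg[OF D K] by (simp add: d_def)
  \<comment> \<open>Every such \<open>t\<close> satisfies \<open>ln C + \<alpha> * t > d * (ln 8 + t)\<close>.\<close>
  define t where "t = max 1 ((d * ln 8 - ln C) / (\<alpha> - d) + 1)"
  define \<kappa> where "\<kappa> = exp (- t)"
  define \<rho> where "\<rho> = \<kappa> / 8"
  have t: "t \<ge> 1" "(d * ln 8 - ln C) < t * (\<alpha> - d)"
  proof -
    have "(d * ln 8 - ln C) / (\<alpha> - d) < t" unfolding t_def by simp
    then show "(d * ln 8 - ln C) < t * (\<alpha> - d)" using \<alpha> by (simp add: pos_divide_less_eq)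
  qed (simp add: t_def)
  have \<kappa>: "0 < \<kappa>" "\<kappa> < 1" using t by (auto simp: \<kappa>_def)
  have \<rho>: "0 < \<rho>" "8 * \<rho> \<le> \<kappa>" "\<kappa> \<le> 1" "\<rho> < 1" using \<kappa> by (auto simp: \<rho>_def)
  define m where "m = nat \<lceil>C * exp (\<alpha> * t)\<rceil>"
  have m: "m > 0" "C * exp (\<alpha> * t) \<le> real m"
    using C by (auto simp: m_def real_nat_ceiling_ge)
  define good where "good x R h \<longleftrightarrow> (\<forall>i<m. h i \<in> E \<and> dist x (h i) \<le> R) \<and>
      (\<forall>i<m. \<forall>j<m. i \<noteq> j \<longrightarrow> \<kappa> * R \<le> dist (h i) (h j))" for x R and h :: "nat \<Rightarrow> 'a"
  have "\<exists>h. good x R h"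
    if x: "x \<in> E" and R: "0 < R" "R \<le> R0" for x R
  proof -
    have ratio: "R / (\<kappa> * R) = exp t"
      using R by (simp add: \<kappa>_def exp_minus field_simps)
    have less: "0 < \<kappa> * R" "\<kappa> * R < R" using R \<kappa> by auto
    have "C * exp (\<alpha> * t) \<le> real (covering_number (cball x R \<inter> E) (\<kappa> * R))"
      using thick[OF x less R(2)] unfolding ratio by (simp add: powr_def)
    then have "m \<le> covering_number (cball x R \<inter> E) (\<kappa> * R)"
      unfolding m_def by linarith
    then obtain P where P: "P \<subseteq> cball x R \<inter> E" "finite P" "card P = m" "separated_by (\<kappa> * R) P"
      using separated_subset_of_size_covering_number[of m "cball x R \<inter> E" "\<kappa> * R"] R \<kappa> by auto
    obtain h where h: "bij_betw h {0..<m} P"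
      using ex_bij_betw_nat_finite[OF P(2)] P(3) by blast
    have "h i \<in> P" if "i < m" for i using h that by (auto simp: bij_betw_def)
    moreover have "h i \<noteq> h j" if "i < m" "j < m" "i \<noteq> j" for i j
      using h that by (auto simp: bij_betw_def inj_on_def)
    moreover have "\<kappa> * R \<le> dist y z" if "y \<in> P" "z \<in> P" "y \<noteq> z" for y z
      using P(4) that unfolding separated_by_def by (blast intro: less_imp_le)
    moreover have "y \<in> E \<and> dist x y \<le> R" if "y \<in> P" for y using P(1) that by auto
    ultimately show ?thesis unfolding good_def by blast
  qed
  then have "\<forall>x R. \<exists>h. x \<in> E \<and> 0 < R \<and> R \<le> R0 \<longrightarrow> good x R h" by blast
  then obtain h where good: "\<And>x R. x \<in> E \<Longrightarrow> 0 < R \<Longrightarrow> R \<le> R0 \<Longrightarrow> good x R (h x R)"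
    by metis
  have h: "h x R i \<in> E \<and> dist x (h x R i) \<le> R" if "x \<in> E" "0 < R" "R \<le> R0" "i < m" for x R i
    using good[OF that(1-3)] that(4) unfolding good_def by blast
  have hsep: "\<kappa> * R \<le> dist (h x R i) (h x R j)"
    if "x \<in> E" "0 < R" "R \<le> R0" "i < m" "j < m" "i \<noteq> j" for x R i j
    using good[OF that(1-3)] that(4-6) unfolding good_def by blast
  have Rk: "0 < R0 * \<rho> ^ k" "R0 * \<rho> ^ k \<le> R0" for k
    using R0 \<rho> by (auto simp: mult_left_le power_le_one)
  obtain \<phi> where \<phi>: "follows_code \<rho> (\<lambda>\<omega>. \<omega>) (symbol_space m) \<phi>" "\<phi> ` symbol_space m \<subseteq> closure E"
    using separated_choices_give_coded_set[where g = "\<lambda>k x. h x (R0 * \<rho> ^ k)",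
        OF \<rho>(1,2,3) R0 x0 h[OF _ Rk] hsep[OF _ Rk]] by blast
  \<comment> \<open>The points chosen in the first ball, rescaled to the unit ball, generate the model.\<close>
  define p where "p i = (h x0 R0 i - x0) /\<^sub>R R0" for i
  have p: "norm (p i) \<le> 1" if "i < m" for i
    using h[OF x0 R0 order_refl that] R0
    by (simp add: p_def dist_norm norm_minus_commute divide_simps)
  have psep: "\<kappa> \<le> dist (p i) (p j)" if "i < m" "j < m" "i \<noteq> j" for i j
  proof -
    have "dist (p i) (p j) = dist (h x0 R0 i) (h x0 R0 j) / R0"
      using R0 by (simp add: p_def dist_norm divide_inverse_commute flip: scaleR_diff_right)
    then show ?thesis using hsep[OF x0 R0 order_refl that] R0 by (simp add: pos_le_divide_eq)
  qed
  let ?A = "\<phi> ` symbol_space m" and ?T = "address_point \<rho> p ` symbol_space m"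
  have "bilipschitz_equivalent ?A ?T"
    by (rule follows_code_bilipschitz_equivalent[OF \<rho>(1,4) \<phi>(1)
          address_point_follows_code[where p = p, OF \<rho>(1,2,3) p psep]])
  moreover have A: "compact ?A" by (rule follows_code_compact[OF \<rho>(1,4) \<phi>(1)])
  moreover note T = coded_set_dimension[where p = p, OF D \<rho>(1,2,3) m(1) p psep]
  ultimately have "D ?A = ln (real m) / ln (1 / \<rho>)"
    using dimension_like_cong[OF D] T by metis
  moreover have "?A \<subseteq> K"
    using \<phi>(2) closure_minimal[OF E compact_imp_closed[OF K]] by blast
  ultimately have "ln (real m) / ln (1 / \<rho>) \<le> d"
    using dimension_like_mono[OF D A K] by (simp add: d_def)
  moreover have ln\<rho>: "ln (1 / \<rho>) = ln 8 + t"
    by (simp add: \<rho>_def \<kappa>_def ln_div ln_mult)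
  ultimately have "ln (real m) \<le> d * (ln 8 + t)"
    using t(1) by (simp add: pos_divide_le_eq add_pos_pos)
  moreover have "ln C + \<alpha> * t \<le> ln (real m)"
    using m C ln_mono[of "C * exp (\<alpha> * t)" "real m"] by (simp add: ln_mult)
  ultimately show False using t(2) by (simp add: algebra_simps)
qed

lemma lower_dim_le:
  fixes D :: "'a::euclidean_space set \<Rightarrow> real"
  assumes D: "dimension_like D" and K: "compact K" and E: "E \<subseteq> K"
  shows "lower_dim E \<le> D K"
proof (cases "\<exists>x\<in>E. \<exists>y\<in>E. x \<noteq> y")
  case True
  then obtain x y where xy: "x \<in> E" "y \<in> E" "x \<noteq> y" by blast
  have bE: "bounded E" using K E compact_imp_bounded bounded_subset by blast
  then have diam: "0 < diameter E"
    using diameter_bounded_bound[OF bE xy(1,2)] xy(3) by (metis less_le_trans zero_less_dist_iff)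
  let ?W = "{\<alpha>. 0 \<le> \<alpha> \<and> (\<exists>C>0. \<forall>x\<in>E. \<forall>r R. 0 < r \<and> r < R \<and> (bounded E \<longrightarrow> R \<le> diameter E) \<longrightarrow>
             real (covering_number (cball x R \<inter> E) r) \<ge> C * (R / r) powr \<alpha>)}"
  have "1 * (R / r) powr 0 \<le> real (covering_number (cball x R \<inter> E) r)"
    if "x \<in> E" "0 < r" "r < R" for x r R
  proof -
    have "card {x} \<le> covering_number (cball x R \<inter> E) r"
      using that bE by (intro card_separated_le_covering_number) (auto simp: separated_by_def)
    then show ?thesis using that by simp
  qed
  then have "0 \<in> ?W" by (intro CollectI conjI exI[of _ "1::real"]) auto
  moreover have "\<alpha> \<le> D K" if \<alpha>: "\<alpha> \<in> ?W" for \<alpha>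
  proof -
    obtain C where C: "C > 0" "\<forall>x\<in>E. \<forall>r R. 0 < r \<and> r < R \<and> (bounded E \<longrightarrow> R \<le> diameter E) \<longrightarrow>
             real (covering_number (cball x R \<inter> E) r) \<ge> C * (R / r) powr \<alpha>"
      using \<alpha> by blast
    then show ?thesis using lower_exponent_le[OF D K E diam C(1) xy(1)] by blast
  qed
  ultimately have "Sup ?W \<le> D K" by (intro cSup_least[of ?W]) blast+
  moreover have "lower_dim E = Sup ?W" using True unfolding lower_dim_def by (rule if_P)
  ultimately show ?thesis by simp
next
  case False
  then show ?thesis using dimension_like_nonneg[OF D K] by (simp add: lower_dim_def)
qed

lemma modified_lower_dim_le:
  fixes D :: "'a::euclidean_space set \<Rightarrow> real"
  assumes "dimension_like D" "compact K"
  shows "modified_lower_dim K \<le> D K"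
proof -
  have "modified_lower_dim K = Sup (lower_dim ` Pow K)"
    unfolding modified_lower_dim_def by (rule arg_cong[of _ _ Sup]) auto
  also have "\<dots> \<le> D K"
    by (rule cSUP_least) (use lower_dim_le[OF assms] in auto)
  finally show ?thesis .
qed

section \<open>Subsets of a line\<close>

text \<open>The balls whose centres are the \<open>2 * \<lceil>R / r\<rceil> + 1\<close> points of a grid of step \<open>r\<close>
  suffice, and \<open>1 < R / r\<close> absorbs the rounding into the factor 5.\<close>

lemma covering_number_line_le:
  fixes X :: "'a::real_normed_vector set"
  assumes b: "norm b = 1" and X: "X \<subseteq> range (\<lambda>t. t *\<^sub>R b)" and x: "x \<in> X" and r: "0 < r" "r < R"
  shows "real (covering_number (cball x R \<inter> X) r) \<le> 5 * (R / r) powr 1"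
proof -
  have dist_b: "dist (u *\<^sub>R b) (v *\<^sub>R b) = \<bar>u - v\<bar>" for u v
    by (simp add: dist_norm b flip: scaleR_diff_left)
  obtain s where s: "x = s *\<^sub>R b" using X x by blast
  define J where "J = \<lceil>R / r\<rceil>"
  have Rr: "1 < R / r" using r by simp
  have J: "R / r \<le> of_int J" "of_int J \<le> R / r + 1" unfolding J_def by linarith+
  have J0: "0 \<le> J" using J Rr by linarith
  define F where "F = (\<lambda>j::int. (s + of_int j * r) *\<^sub>R b) ` {-J..J}"
  have "finite F" unfolding F_def by simp
  moreover have "cball x R \<inter> X \<subseteq> (\<Union>c\<in>F. cball c r)"
  proof
    fix y assume y: "y \<in> cball x R \<inter> X"
    then obtain t where t: "y = t *\<^sub>R b" using X by blast
    have "\<bar>s - t\<bar> \<le> R" using y by (simp add: s t b)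
    define q where "q = (t - s) / r"
    have q: "t = s + q * r" "\<bar>q\<bar> \<le> R / r"
      using r \<open>\<bar>s - t\<bar> \<le> R\<close> by (auto simp: q_def field_simps abs_le_iff)
    have "\<lfloor>q\<rfloor> \<in> {-J..J}" using q(2) J(1) by (auto simp: abs_le_iff) linarith+
    moreover have "dist ((s + of_int \<lfloor>q\<rfloor> * r) *\<^sub>R b) y \<le> r"
    proof -
      have "dist ((s + of_int \<lfloor>q\<rfloor> * r) *\<^sub>R b) y = \<bar>(of_int \<lfloor>q\<rfloor> - q) * r\<bar>"
        unfolding t dist_b q(1) by (simp add: algebra_simps)
      also have "\<dots> = \<bar>of_int \<lfloor>q\<rfloor> - q\<bar> * r" using r by (simp add: abs_mult)
      also have "\<dots> \<le> 1 * r" using r by (intro mult_right_mono) linarith+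
      finally show ?thesis by simp
    qed
    ultimately show "y \<in> (\<Union>c\<in>F. cball c r)" unfolding F_def by auto
  qed
  ultimately have "covering_number (cball x R \<inter> X) r \<le> card F" by (rule covering_number_le_card)
  also have "card F \<le> card {-J..J}" unfolding F_def by (rule card_image_le) simp
  also have "card {-J..J} = nat (2 * J + 1)" by simp
  finally have "real (covering_number (cball x R \<inter> X) r) \<le> real (nat (2 * J + 1))" by simp
  also have "\<dots> = 2 * of_int J + 1" using J0 by simp
  also have "\<dots> \<le> 5 * (R / r)" using J Rr by linarith
  also have "\<dots> = 5 * (R / r) powr 1" using r by simp
  finally show ?thesis .
qed

lemma DIM_1_coordinate:
  assumes "DIM('a::euclidean_space) = 1"
  obtains b :: "'a::euclidean_space" where "norm b = 1" "\<And>x. x = (x \<bullet> b) *\<^sub>R b" "\<And>x y. dist x y = \<bar>x \<bullet> b - y \<bullet> b\<bar>"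
proof -
  obtain b :: 'a where b: "Basis = {b}" using assms by (auto simp: card_1_singleton_iff)
  have 1: "norm b = 1" by (rule norm_Basis) (simp add: b)
  have 2: "x = (x \<bullet> b) *\<^sub>R b" for x using euclidean_representation[of x] unfolding b by simp
  have "dist x y = \<bar>x \<bullet> b - y \<bullet> b\<bar>" for x y
  proof -
    have "dist x y = norm (((x - y) \<bullet> b) *\<^sub>R b)" using 2[of "x - y"] by (simp add: dist_norm)
    then show ?thesis using 1 by (simp add: inner_diff_left)
  qed
  with 1 2 show ?thesis using that by blast
qed

text \<open>Points joined by a chain in \<open>K\<close> with steps of length at most \<open>\<delta>\<close>. The reflexive
  closure makes a point outside \<open>K\<close> a class of its own, so this is an equivalence relation on the
  whole type.\<close>

definition chain_rel :: "real \<Rightarrow> 'a::metric_space set \<Rightarrow> ('a \<times> 'a) set" where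
  "chain_rel \<delta> K = {(x, y). x \<in> K \<and> y \<in> K \<and> dist x y \<le> \<delta>}\<^sup>*"

lemma chain_rel_sym: "(x, y) \<in> chain_rel \<delta> K \<Longrightarrow> (y, x) \<in> chain_rel \<delta> K"
proof -
  have "sym {(x, y). x \<in> K \<and> y \<in> K \<and> dist x y \<le> \<delta>}" by (auto simp: sym_def dist_commute)
  then show "(x, y) \<in> chain_rel \<delta> K \<Longrightarrow> (y, x) \<in> chain_rel \<delta> K"
    unfolding chain_rel_def by (meson sym_rtrancl symE)
qed

lemma chain_rel_classes_eq_iff: "chain_rel \<delta> K `` {x} = chain_rel \<delta> K `` {y} \<longleftrightarrow> (x, y) \<in> chain_rel \<delta> K"
proof
  assume "chain_rel \<delta> K `` {x} = chain_rel \<delta> K `` {y}"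
  moreover have "(y, y) \<in> chain_rel \<delta> K" unfolding chain_rel_def by simp
  ultimately show "(x, y) \<in> chain_rel \<delta> K" by blast
next
  have trans: "(u, v) \<in> chain_rel \<delta> K \<Longrightarrow> (v, w) \<in> chain_rel \<delta> K \<Longrightarrow> (u, w) \<in> chain_rel \<delta> K" for u v w
    unfolding chain_rel_def by (rule rtrancl_trans)
  assume "(x, y) \<in> chain_rel \<delta> K"
  then show "chain_rel \<delta> K `` {x} = chain_rel \<delta> K `` {y}"
    using trans chain_rel_sym by (auto dest: trans chain_rel_sym)
qed

lemma chain_rel_mono: "\<delta> \<le> \<epsilon> \<Longrightarrow> chain_rel \<delta> K \<subseteq> chain_rel \<epsilon> K"
  unfolding chain_rel_def by (rule rtrancl_mono) auto

text \<open>A chain from \<open>x\<close> to \<open>y\<close> cannot jump over a value that lies between their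
  coordinates by more than one step.\<close>

lemma chain_rel_no_gap:
  fixes K :: "'a::euclidean_space set"
  assumes "(x, y) \<in> chain_rel \<delta> K" "x \<in> K" "\<delta> > 0" and b: "norm b = 1"
    and "min (x \<bullet> b) (y \<bullet> b) \<le> u" "u \<le> max (x \<bullet> b) (y \<bullet> b)"
  shows "\<exists>z\<in>K. \<bar>z \<bullet> b - u\<bar> \<le> \<delta>"
  using assms(1,5,6) unfolding chain_rel_def
proof (induction rule: rtrancl_induct)
  case base
  then show ?case using assms(2,3) by (intro bexI[of _ x]) auto
next
  case (step y z)
  then have yz: "y \<in> K" "z \<in> K" "dist y z \<le> \<delta>" by auto
  have "\<bar>y \<bullet> b - z \<bullet> b\<bar> \<le> dist y z"
    using Cauchy_Schwarz_ineq2[of "y - z" b] b by (simp add: dist_norm inner_diff_left)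
  then have close: "\<bar>y \<bullet> b - z \<bullet> b\<bar> \<le> \<delta>" using yz by simp
  show ?case
  proof (cases "min (x \<bullet> b) (y \<bullet> b) \<le> u \<and> u \<le> max (x \<bullet> b) (y \<bullet> b)")
    case True
    then show ?thesis using step.IH by blast
  next
    case False
    then have "\<bar>y \<bullet> b - u\<bar> \<le> \<delta>" using step.prems close by (auto simp: min_def max_def split: if_splits)
    then show ?thesis using yz by blast
  qed
qed

text \<open>Since \<open>5 * J + 1 \<le> 6 * J\<close>, it suffices that
  \<open>J powr (1 - \<alpha>)\<close> exceeds \<open>C * 6 powr \<alpha>\<close>.\<close>

lemma linear_beats_sublinear_power:
  fixes C \<alpha> :: real
  assumes "C > 0" "0 \<le> \<alpha>" "\<alpha> < 1"
  shows "\<exists>J::nat. J > 0 \<and> C * (5 * real J + 1) powr \<alpha> < real J"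
proof -
  obtain J :: nat where J: "(C * 6 powr \<alpha>) powr (1 / (1 - \<alpha>)) < real J" using reals_Archimedean2 by blast
  then have J0: "real J > 0" using assms by (smt (verit) powr_ge_zero)
  have "C * 6 powr \<alpha> = ((C * 6 powr \<alpha>) powr (1 / (1 - \<alpha>))) powr (1 - \<alpha>)"
    using assms by (simp add: powr_powr)
  also have "\<dots> < real J powr (1 - \<alpha>)" using J assms by (intro powr_less_mono2) auto
  finally have 1: "C * 6 powr \<alpha> < real J powr (1 - \<alpha>)" .
  have "C * (5 * real J + 1) powr \<alpha> \<le> C * (6 * real J) powr \<alpha>"
    using assms J0 by (intro mult_left_mono powr_mono2) auto
  also have "\<dots> = (C * 6 powr \<alpha>) * real J powr \<alpha>" using J0 by (simp add: powr_mult)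
  also have "\<dots> < real J powr (1 - \<alpha>) * real J powr \<alpha>" using 1 J0 by (intro mult_strict_right_mono) auto
  also have "\<dots> = real J" using J0 by (simp flip: powr_add)
  finally show ?thesis using J0 by auto
qed

text \<open>A chain from \<open>x\<close> that reaches further than \<open>M * \<delta>\<close>, with \<open>M = 5 * J + 1\<close>, passes
  within \<open>\<delta>\<close> of the positions at distance \<open>5 * j * \<delta>\<close> from \<open>x\<close>, \<open>j \<le> J\<close>. This gives \<open>J\<close> points
  at mutual distances at least \<open>3 * \<delta>\<close> in a ball of radius \<open>M * \<delta>\<close>, whereas the covering hypothesis
  allows only \<open>C * M powr \<alpha>\<close> of them, which is below \<open>J\<close> for large \<open>J\<close> as \<open>\<alpha> < 1\<close>.\<close>

lemma chains_have_small_diameter: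
  fixes K :: "'a::euclidean_space set"
  assumes b: "norm b = 1" "\<And>x y::'a. dist x y = \<bar>x \<bullet> b - y \<bullet> b\<bar>" and K: "bounded K"
    and C: "C > 0" and \<alpha>: "0 \<le> \<alpha>" "\<alpha> < 1"
    and thin: "\<And>x r R. x \<in> K \<Longrightarrow> 0 < r \<Longrightarrow> r < R \<Longrightarrow>
       real (covering_number (cball x R \<inter> K) r) \<le> C * (R / r) powr \<alpha>"
  shows "\<exists>M\<ge>1. \<forall>\<delta>>0. \<forall>x\<in>K. \<forall>y. (x, y) \<in> chain_rel \<delta> K \<longrightarrow> dist x y \<le> M * \<delta>"
proof -
  obtain J :: nat where J: "J > 0" "C * (5 * real J + 1) powr \<alpha> < real J"
    using linear_beats_sublinear_power[OF C \<alpha>] by blast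
  define M where "M = 5 * real J + 1"
  have M: "M > 1" using J by (simp add: M_def)
  have "dist x y \<le> M * \<delta>" if \<delta>: "\<delta> > 0" and x: "x \<in> K" and xy: "(x, y) \<in> chain_rel \<delta> K" for \<delta> x y
  proof (rule ccontr)
    assume "\<not> dist x y \<le> M * \<delta>"
    then have far: "M * \<delta> < \<bar>x \<bullet> b - y \<bullet> b\<bar>" using b by simp
    \<comment> \<open>The direction of \<open>y\<close> as seen from \<open>x\<close>.\<close>
    define \<sigma> :: real where "\<sigma> = (if x \<bullet> b \<le> y \<bullet> b then 1 else -1)"
    have "\<exists>z\<in>K. \<bar>z \<bullet> b - (x \<bullet> b + \<sigma> * (5 * real j * \<delta>))\<bar> \<le> \<delta>" if j: "j \<le> J" for j
    proof (rule chain_rel_no_gap[OF xy x \<delta> b(1)])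
      have "0 \<le> 5 * real j * \<delta>" using \<delta> by simp
      moreover have "5 * real j * \<delta> \<le> M * \<delta>" using \<delta> j by (intro mult_right_mono) (auto simp: M_def)
      ultimately have "min (x \<bullet> b) (y \<bullet> b) \<le> x \<bullet> b + \<sigma> * (5 * real j * \<delta>) \<and>
        x \<bullet> b + \<sigma> * (5 * real j * \<delta>) \<le> max (x \<bullet> b) (y \<bullet> b)"
        using far by (cases "x \<bullet> b \<le> y \<bullet> b") (simp_all only: \<sigma>_def if_True if_False, linarith+)
      then show "min (x \<bullet> b) (y \<bullet> b) \<le> x \<bullet> b + \<sigma> * (5 * real j * \<delta>)"
        "x \<bullet> b + \<sigma> * (5 * real j * \<delta>) \<le> max (x \<bullet> b) (y \<bullet> b)"
        by blast+
    qed
    then obtain z where z: "\<And>j. j \<le> J \<Longrightarrow> z j \<in> K"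
      "\<And>j. j \<le> J \<Longrightarrow> \<bar>z j \<bullet> b - (x \<bullet> b + \<sigma> * (5 * real j * \<delta>))\<bar> \<le> \<delta>" by metis
    have sep: "2 * \<delta> < dist (z i) (z j)" if ij: "i \<le> J" "j \<le> J" "i \<noteq> j" for i j
    proof -
      have "1 \<le> \<bar>real i - real j\<bar>" using ij by linarith
      then have "5 * \<delta> * 1 \<le> 5 * \<delta> * \<bar>real i - real j\<bar>" using \<delta> by (intro mult_left_mono) auto
      also have "\<dots> = \<bar>\<sigma> * (5 * \<delta>) * (real i - real j)\<bar>"
        using \<delta> by (simp only: abs_mult) (simp add: \<sigma>_def)
      also have "\<sigma> * (5 * \<delta>) * (real i - real j) = \<sigma> * (5 * real i * \<delta>) - \<sigma> * (5 * real j * \<delta>)"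
        by (simp add: algebra_simps)
      finally have "5 * \<delta> \<le> \<bar>\<sigma> * (5 * real i * \<delta>) - \<sigma> * (5 * real j * \<delta>)\<bar>" by simp
      then show ?thesis using z(2)[OF ij(1)] z(2)[OF ij(2)] \<delta> unfolding b(2) by linarith
    qed
    let ?P = "z ` {1..J}"
    have "inj_on z {1..J}"
    proof (rule inj_onI, rule ccontr)
      fix i j assume "i \<in> {1..J}" "j \<in> {1..J}" "z i = z j" "i \<noteq> j"
      then show False using sep[of i j] \<delta> by auto
    qed
    then have "card ?P = J" by (simp add: card_image)
    moreover have "separated_by (2 * \<delta>) ?P" unfolding separated_by_def by (auto intro!: sep)
    moreover have "?P \<subseteq> cball x (M * \<delta>) \<inter> K"
    proof
      fix w assume "w \<in> ?P"
      then obtain j where j: "j \<le> J" "w = z j" by auto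
      have "5 * real j * \<delta> \<le> 5 * real J * \<delta>" using \<delta> j by (intro mult_right_mono) auto
      then have "\<bar>\<sigma> * (5 * real j * \<delta>)\<bar> \<le> 5 * real J * \<delta>" using \<delta> by (simp add: \<sigma>_def abs_mult)
      then have "\<bar>x \<bullet> b - z j \<bullet> b\<bar> \<le> 5 * real J * \<delta> + \<delta>" using z(2)[OF j(1)] by linarith
      then show "w \<in> cball x (M * \<delta>) \<inter> K" using z(1) j b(2) by (simp add: M_def algebra_simps)
    qed
    ultimately have "J \<le> covering_number (cball x (M * \<delta>) \<inter> K) \<delta>"
      using card_separated_le_covering_number[of \<delta> ?P "cball x (M * \<delta>) \<inter> K"] \<delta> K by (simp add: bounded_Int)
    then have "real J \<le> real (covering_number (cball x (M * \<delta>) \<inter> K) \<delta>)" by simp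
    also have "\<dots> \<le> C * (M * \<delta> / \<delta>) powr \<alpha>" using thin[OF x \<delta>, of "M * \<delta>"] M \<delta> by simp
    also have "\<dots> = C * M powr \<alpha>" using \<delta> by simp
    finally show False using J(2) by (simp add: M_def)
  qed
  then show ?thesis using M by (intro exI[of _ M]) auto
qed

text \<open>The \<open>k\<close>-th symbol numbers the class at level \<open>k + 1\<close> among those contained in
  the same class at level \<open>k\<close>. The numbering depends only on the class at level \<open>k\<close>, so it can be
  compared for two points of that class.\<close>

lemma nested_partitions_give_code:
  fixes E :: "nat \<Rightarrow> 'a \<Rightarrow> 'b"
  assumes start: "\<And>x y. x \<in> K \<Longrightarrow> y \<in> K \<Longrightarrow> E 0 x = E 0 y"
    and refine: "\<And>k x y. E (Suc k) x = E (Suc k) y \<Longrightarrow> E k x = E k y"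
    and few: "\<And>k x. x \<in> K \<Longrightarrow> finite (E (Suc k) ` {y \<in> K. E k y = E k x}) \<and>
                card (E (Suc k) ` {y \<in> K. E k y = E k x}) \<le> m"
  obtains code where "\<And>x. x \<in> K \<Longrightarrow> code x \<in> symbol_space m"
    "\<And>x y k. x \<in> K \<Longrightarrow> y \<in> K \<Longrightarrow> (\<forall>l<k. code x l = code y l) \<longleftrightarrow> E k x = E k y"
proof -
  define Q where "Q k q = E (Suc k) ` {y \<in> K. E k y = q}" for k q
  have "\<exists>h::'b \<Rightarrow> nat. q \<in> E k ` K \<longrightarrow> inj_on h (Q k q) \<and> h ` Q k q \<subseteq> {..<m}" for k q
  proof (cases "q \<in> E k ` K")
    case True
    then have "finite (Q k q)" "card (Q k q) \<le> card {..<m}" using few unfolding Q_def by auto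
    then show ?thesis using card_le_inj[of "Q k q" "{..<m}"] by auto
  qed simp
  then have "\<exists>h. \<forall>k q. q \<in> E k ` K \<longrightarrow> inj_on (h k q) (Q k q) \<and> h k q ` Q k q \<subseteq> {..<m}"
    by (intro choice allI)
  then obtain h :: "nat \<Rightarrow> 'b \<Rightarrow> 'b \<Rightarrow> nat" where
    h: "\<And>k q. q \<in> E k ` K \<Longrightarrow> inj_on (h k q) (Q k q) \<and> h k q ` Q k q \<subseteq> {..<m}" by blast
  define code where "code x k = h k (E k x) (E (Suc k) x)" for x k
  have Q: "E (Suc k) x \<in> Q k (E k x)" if "x \<in> K" for x k using that unfolding Q_def by auto
  have "code x k < m" if "x \<in> K" for x k
    using h[of "E k x" k] Q[OF that] that unfolding code_def by blast
  then have 1: "code x \<in> symbol_space m" if "x \<in> K" for x using that by (simp add: symbol_space_def)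
  have 2: "(\<forall>l<k. code x l = code y l) \<longleftrightarrow> E k x = E k y" if xy: "x \<in> K" "y \<in> K" for x y k
  proof (induction k)
    case 0
    show ?case using start[OF xy] by simp
  next
    case (Suc k)
    have "(\<forall>l<Suc k. code x l = code y l) \<longleftrightarrow> E k x = E k y \<and> code x k = code y k"
      using Suc.IH by (auto simp: less_Suc_eq)
    also have "\<dots> \<longleftrightarrow> E (Suc k) x = E (Suc k) y"
    proof
      assume *: "E k x = E k y \<and> code x k = code y k"
      then have "inj_on (h k (E k x)) (Q k (E k x))" using h xy by blast
      moreover have "h k (E k x) (E (Suc k) x) = h k (E k x) (E (Suc k) y)"
        using * unfolding code_def by metis
      ultimately show "E (Suc k) x = E (Suc k) y"
        using Q[OF xy(1), of k] Q[OF xy(2), of k] * by (auto dest: inj_onD)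
    qed (use refine[of k x y] in \<open>auto simp: code_def\<close>)
    finally show ?case .
  qed
  show ?thesis using that 1 2 by blast
qed

text \<open>The classes are the chain classes at the scales \<open>\<Delta> * \<rho> ^ k\<close>, where \<open>\<Delta>\<close> exceeds the
  diameter of \<open>K\<close>, so that level 0 has one class. Points in one class at level \<open>k\<close> are at distance at
  most \<open>M * \<Delta> * \<rho> ^ k\<close>, points in different classes at level \<open>k + 1\<close> at distance more than
  \<open>\<Delta> * \<rho> ^ (k + 1)\<close>. Representatives of the subclasses of one class are therefore a separated set in
  a ball that is larger by the factor \<open>2 * M / \<rho>\<close> than half their separation, and the covering
  hypothesis bounds their number.\<close>

lemma thin_set_has_code:
  fixes K :: "'a::euclidean_space set"
  assumes K: "bounded K" and C: "C > 0" and M: "M \<ge> 1" and \<rho>: "0 < \<rho>" "\<rho> < 1"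
    and thin: "\<And>x r R. x \<in> K \<Longrightarrow> 0 < r \<Longrightarrow> r < R \<Longrightarrow>
       real (covering_number (cball x R \<inter> K) r) \<le> C * (R / r) powr \<alpha>"
    and chains: "\<And>\<delta> x y. \<delta> > 0 \<Longrightarrow> x \<in> K \<Longrightarrow> (x, y) \<in> chain_rel \<delta> K \<Longrightarrow> dist x y \<le> M * \<delta>"
    and m: "m = nat \<lfloor>C * (2 * M / \<rho>) powr \<alpha>\<rfloor>"
  obtains code where "\<And>x. x \<in> K \<Longrightarrow> code x \<in> symbol_space m" "follows_code \<rho> code K (\<lambda>x. x)"
proof -
  define \<Delta> where "\<Delta> = diameter K + 1"
  have \<Delta>: "\<Delta> > 0" "\<And>x y. x \<in> K \<Longrightarrow> y \<in> K \<Longrightarrow> dist x y \<le> \<Delta>"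
    using diameter_ge_0[OF K] diameter_bounded_bound[OF K] by (fastforce simp: \<Delta>_def)+
  define \<delta> where "\<delta> k = \<Delta> * \<rho> ^ k" for k
  have \<delta>: "\<delta> k > 0" "\<delta> (Suc k) \<le> \<delta> k" for k
    using \<Delta> \<rho> by (auto simp: \<delta>_def mult_left_le_one_le)
  define E where "E k x = chain_rel (\<delta> k) K `` {x}" for k x
  have E_eq: "E k x = E k y \<longleftrightarrow> (x, y) \<in> chain_rel (\<delta> k) K" for k x y
    unfolding E_def by (rule chain_rel_classes_eq_iff)
  have close: "E k x = E k y" if "x \<in> K" "y \<in> K" "dist x y \<le> \<delta> k" for k x y
    unfolding E_eq chain_rel_def using that by auto
  have few: "finite (E (Suc k) ` {y \<in> K. E k y = E k x}) \<and>
                card (E (Suc k) ` {y \<in> K. E k y = E k x}) \<le> m" if x: "x \<in> K" for k x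
  proof (rule finite_if_finite_subsets_card_bdd)
    fix G assume G: "G \<subseteq> E (Suc k) ` {y \<in> K. E k y = E k x}" "finite G"
    then obtain U where U: "U \<subseteq> {y \<in> K. E k y = E k x}" "inj_on (E (Suc k)) U" "G = E (Suc k) ` U"
      by (auto simp: subset_image_inj)
    have "separated_by (2 * (\<delta> (Suc k) / 2)) U"
      unfolding separated_by_def
    proof (intro ballI impI, rule ccontr)
      fix y z assume yz: "y \<in> U" "z \<in> U" "y \<noteq> z" "\<not> 2 * (\<delta> (Suc k) / 2) < dist y z"
      then have "E (Suc k) y = E (Suc k) z" using close[of y z "Suc k"] U(1) by auto
      then show False using yz U(2) by (auto dest: inj_onD)
    qed
    moreover have "U \<subseteq> cball x (M * \<delta> k) \<inter> K"
    proof
      fix y assume "y \<in> U"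
      then have "y \<in> K" "E k x = E k y" using U(1) by auto
      then show "y \<in> cball x (M * \<delta> k) \<inter> K"
        using chains[OF \<delta>(1) x] unfolding E_eq by simp
    qed
    ultimately have "card U \<le> covering_number (cball x (M * \<delta> k) \<inter> K) (\<delta> (Suc k) / 2)"
      using card_separated_le_covering_number[of "\<delta> (Suc k) / 2" U "cball x (M * \<delta> k) \<inter> K"] \<delta> K
      by (simp add: bounded_Int)
    also have "real \<dots> \<le> C * (M * \<delta> k / (\<delta> (Suc k) / 2)) powr \<alpha>"
    proof (rule thin[OF x])
      have "\<delta> (Suc k) / 2 < \<delta> k" using \<delta>(1)[of "Suc k"] \<delta>(2)[of k] by linarith
      also have "\<delta> k \<le> M * \<delta> k" using M \<delta>(1)[of k] by simp
      finally show "\<delta> (Suc k) / 2 < M * \<delta> k" .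
    qed (use \<delta> in simp)
    also have "M * \<delta> k / (\<delta> (Suc k) / 2) = 2 * M / \<rho>"
      using \<Delta> \<rho> by (simp add: \<delta>_def)
    finally have "real (card U) \<le> C * (2 * M / \<rho>) powr \<alpha>" by simp
    then have "card U \<le> m" unfolding m by linarith
    then show "card G \<le> m" using U by (simp add: card_image)
  qed
  have start: "E 0 x = E 0 y" if "x \<in> K" "y \<in> K" for x y
    using close[OF that, of 0] \<Delta>(2)[OF that] by (simp add: \<delta>_def)
  have refine: "E k x = E k y" if "E (Suc k) x = E (Suc k) y" for k x y
    using that chain_rel_mono[OF \<delta>(2)[of k], of K] unfolding E_eq by blast
  obtain code where code: "\<And>x. x \<in> K \<Longrightarrow> code x \<in> symbol_space m"
    and agree: "\<And>x y k. x \<in> K \<Longrightarrow> y \<in> K \<Longrightarrow> (\<forall>l<k. code x l = code y l) \<longleftrightarrow> E k x = E k y"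
    using nested_partitions_give_code[of K E m, OF start refine few] by blast
  have up: "dist x y \<le> M * \<Delta> * \<rho> ^ k" if "x \<in> K" "y \<in> K" "\<forall>l<k. code x l = code y l" for x y k
  proof -
    have "E k x = E k y" using agree that by blast
    then show ?thesis using chains[OF \<delta>(1) that(1)] unfolding E_eq by (simp add: \<delta>_def mult_ac)
  qed
  have lo: "\<Delta> * \<rho> * \<rho> ^ k \<le> dist x y"
    if "x \<in> K" "y \<in> K" "\<forall>l<k. code x l = code y l" "code x k \<noteq> code y k" for x y k
  proof -
    have "E (Suc k) x \<noteq> E (Suc k) y" using agree[OF that(1,2), of "Suc k"] that(4) by auto
    then have "\<delta> (Suc k) < dist x y" using close[OF that(1,2), of "Suc k"] by fastforce
    then show ?thesis by (simp add: \<delta>_def)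
  qed
  have "\<Delta> * \<rho> > 0" "M * \<Delta> > 0" using \<Delta> \<rho> M by auto
  then have "follows_code \<rho> code K (\<lambda>x. x)"
    unfolding follows_code_def using up lo by blast
  with code show ?thesis using that by blast
qed

section \<open>The upper bound on the line\<close>

text \<open>For an exponent \<open>e\<close> strictly between \<open>\<alpha>\<close> and \<open>D K \<le> 1\<close> and small
  \<open>\<rho> = exp (- t)\<close>, the number \<open>m\<close> of symbols that \<open>K\<close> needs is at most \<open>\<rho> powr - e\<close>. As \<open>e < 1\<close>, the
  equidistant points \<open>i / m\<close> of the unit interval are then at least \<open>8 * \<rho>\<close> apart and generate a model
  of dimension at most \<open>e\<close> into which \<open>K\<close> embeds.\<close>

lemma assouad_exponent_ge:
  fixes D :: "'a::euclidean_space set \<Rightarrow> real"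
  assumes D: "dimension_like D" and dim1: "DIM('a) = 1" and K: "compact K"
    and C: "C > 0" and \<alpha>: "0 \<le> \<alpha>"
    and thin: "\<And>x r R. x \<in> K \<Longrightarrow> 0 < r \<Longrightarrow> r < R \<Longrightarrow>
       real (covering_number (cball x R \<inter> K) r) \<le> C * (R / r) powr \<alpha>"
  shows "D K \<le> \<alpha>"
proof (rule ccontr)
  assume neg: "\<not> D K \<le> \<alpha>"
  have D1: "D K \<le> 1" using dimension_like_le_DIM[OF D K] dim1 by simp
  define e where "e = (\<alpha> + D K) / 2"
  have e: "\<alpha> < e" "e < D K" "e < 1" "\<alpha> < 1" using neg D1 by (auto simp: e_def)
  obtain b :: 'a where b: "norm b = 1" "\<And>x. x = (x \<bullet> b) *\<^sub>R b" "\<And>x y::'a. dist x y = \<bar>x \<bullet> b - y \<bullet> b\<bar>"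
    using DIM_1_coordinate[OF dim1] by blast
  have bK: "bounded K" using K by (rule compact_imp_bounded)
  \<comment> \<open>A constant at least 1 guarantees \<open>m > 0\<close>.\<close>
  define C' where "C' = max 1 C"
  have C': "C' \<ge> 1" "C' > 0" "C \<le> C'" by (auto simp: C'_def)
  obtain M where M: "M \<ge> 1"
    and chains: "\<And>\<delta> x y. \<delta> > 0 \<Longrightarrow> x \<in> K \<Longrightarrow> (x, y) \<in> chain_rel \<delta> K \<Longrightarrow> dist x y \<le> M * \<delta>"
    using chains_have_small_diameter[OF b(1,3) bK C \<alpha> e(4) thin] by blast
  define H where "H = ln C' + \<alpha> * ln (2 * M)"
  \<comment> \<open>The second term makes \<open>m \<le> \<rho> powr - e\<close>, the third makes \<open>8 * \<rho> * m \<le> 1\<close>.\<close>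
  define t where "t = max 1 (max (H / (e - \<alpha>)) (ln 8 / (1 - e)))"
  have t: "t \<ge> 1" "H / (e - \<alpha>) \<le> t" "ln 8 / (1 - e) \<le> t" unfolding t_def by linarith+
  have tH: "H + \<alpha> * t \<le> e * t"
    using t(2) e by (simp add: pos_divide_le_eq algebra_simps)
  have t8: "ln 8 + e * t \<le> t"
    using t(3) e by (simp add: pos_divide_le_eq algebra_simps)
  define \<rho> where "\<rho> = exp (- t)"
  have \<rho>: "0 < \<rho>" "\<rho> < 1" using t(1) by (auto simp: \<rho>_def)
  define B where "B = C' * (2 * M / \<rho>) powr \<alpha>"
  define m where "m = nat \<lfloor>B\<rfloor>"
  have base: "2 * M / \<rho> \<ge> 1"
  proof -
    have "\<rho> \<le> 2 * M" using \<rho> M by linarith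
    then show ?thesis using \<rho> by simp
  qed
  have B1: "B \<ge> 1"
  proof -
    have "1 * 1 \<le> C' * (2 * M / \<rho>) powr \<alpha>"
      using C' base \<alpha> by (intro mult_mono ge_one_powr_ge_zero) auto
    then show ?thesis by (simp add: B_def)
  qed
  have lnB: "ln B = H + \<alpha> * t"
    using C' M \<rho> by (simp add: B_def H_def \<rho>_def ln_mult ln_powr ln_div algebra_simps)
  have m: "m > 0" "real m \<le> B" using B1 by (auto simp: m_def)
  have lnm: "ln (real m) \<le> e * t"
  proof -
    have "ln (real m) \<le> ln B" using m by simp
    then show ?thesis using lnB tH by simp
  qed
  have "ln (8 * \<rho> * real m) \<le> ln 1"
    using lnm t8 m by (simp add: ln_mult \<rho>_def)
  then have small: "8 * \<rho> * real m \<le> 1" using \<rho> m by (subst (asm) ln_le_cancel_iff) auto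
  define \<kappa> where "\<kappa> = 1 / real m"
  have \<rho>\<kappa>: "8 * \<rho> \<le> \<kappa>" "\<kappa> \<le> 1" using small m by (auto simp: \<kappa>_def field_simps)
  define p where "p i = (real i / real m) *\<^sub>R b" for i
  have p: "norm (p i) \<le> 1" if "i < m" for i using that b(1) by (simp add: p_def)
  have sep: "\<kappa> \<le> dist (p i) (p j)" if "i < m" "j < m" "i \<noteq> j" for i j
  proof -
    have "dist (p i) (p j) = \<bar>real i / real m - real j / real m\<bar>"
      using b(1) by (simp add: p_def dist_norm flip: scaleR_diff_left)
    also have "\<dots> = \<bar>real i - real j\<bar> / real m" by (simp flip: diff_divide_distrib)
    finally show ?thesis using that m(1) unfolding \<kappa>_def by (simp add: divide_right_mono)
  qed
  have thin': "real (covering_number (cball x R \<inter> K) r) \<le> C' * (R / r) powr \<alpha>"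
    if "x \<in> K" "0 < r" "r < R" for x r R
    using thin[OF that] C'(3) by (meson mult_right_mono order_trans powr_ge_zero)
  obtain code where code: "\<And>x. x \<in> K \<Longrightarrow> code x \<in> symbol_space m" "follows_code \<rho> code K (\<lambda>x. x)"
    using thin_set_has_code[OF bK C'(2) M \<rho> thin' chains, of m] unfolding m_def B_def by blast
  have "follows_code \<rho> (\<lambda>\<omega>. \<omega>) (symbol_space m) (address_point \<rho> p)"
    by (rule address_point_follows_code[where p = p, OF \<rho>(1) \<rho>\<kappa> p sep])
  then have "follows_code \<rho> code K (\<lambda>x. address_point \<rho> p (code x))"
    using code(1) unfolding follows_code_def by meson
  from follows_code_bilipschitz_equivalent[OF \<rho> code(2) this]
  have eqv: "bilipschitz_equivalent K ((\<lambda>x. address_point \<rho> p (code x)) ` K)" by simp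
  let ?K' = "(\<lambda>x. address_point \<rho> p (code x)) ` K" and ?S = "address_point \<rho> p ` symbol_space m"
  obtain g where "bilipschitz_embedding g K" "g ` K = ?K'"
    using bilipschitz_equivalent_embeddings(1)[OF eqv] by blast
  then have K': "compact ?K'"
    using compact_continuous_image[OF bilipschitz_embedding_continuous_on K] by metis
  note S = coded_set_dimension[where p = p, OF D \<rho>(1) \<rho>\<kappa> m(1) p sep]
  have "D K = D ?K'" by (rule dimension_like_cong[OF D K K' eqv])
  also have "\<dots> \<le> D ?S" by (rule dimension_like_mono[OF D K' S(2)]) (use code(1) in auto)
  also have "\<dots> = ln (real m) / t" using S(1) by (simp add: \<rho>_def ln_div)
  also have "\<dots> \<le> e" using lnm t(1) by (simp add: pos_divide_le_eq)
  finally show False using e(2) by simp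
qed

text \<open>On a line the exponent 1 always satisfies the covering estimate, so the infimum in the
  Assouad dimension is taken over a nonempty set.\<close>

lemma assouad_dim_ge:
  fixes D :: "'a::euclidean_space set \<Rightarrow> real"
  assumes D: "dimension_like D" and dim1: "DIM('a) = 1" and K: "compact K"
  shows "D K \<le> assouad_dim K"
  unfolding assouad_dim_def
proof (rule cInf_greatest)
  obtain b :: 'a where b: "norm b = 1" "\<And>x. x = (x \<bullet> b) *\<^sub>R b"
    using DIM_1_coordinate[OF dim1] by metis
  have "K \<subseteq> range (\<lambda>t. t *\<^sub>R b)" using b(2) by blast
  from covering_number_line_le[OF b(1) this]
  have "(1::real) \<in> {\<alpha>. 0 \<le> \<alpha> \<and> (\<exists>C>0. \<forall>x\<in>K. \<forall>r R. 0 < r \<and> r < R \<longrightarrow>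
          real (covering_number (cball x R \<inter> K) r) \<le> C * (R / r) powr \<alpha>)}"
    by (intro CollectI conjI exI[of _ "5::real"]) auto
  then show "{\<alpha>. 0 \<le> \<alpha> \<and> (\<exists>C>0. \<forall>x\<in>K. \<forall>r R. 0 < r \<and> r < R \<longrightarrow>
          real (covering_number (cball x R \<inter> K) r) \<le> C * (R / r) powr \<alpha>)} \<noteq> {}" by blast
next
  fix \<alpha> assume "\<alpha> \<in> {\<alpha>. 0 \<le> \<alpha> \<and> (\<exists>C>0. \<forall>x\<in>K. \<forall>r R. 0 < r \<and> r < R \<longrightarrow>
          real (covering_number (cball x R \<inter> K) r) \<le> C * (R / r) powr \<alpha>)}"
  then obtain C where "0 \<le> \<alpha>" "C > 0" "\<forall>x\<in>K. \<forall>r R. 0 < r \<and> r < R \<longrightarrow>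
          real (covering_number (cball x R \<inter> K) r) \<le> C * (R / r) powr \<alpha>" by blast
  then show "D K \<le> \<alpha>" using assouad_exponent_ge[OF D dim1 K] by blast
qed

section \<open>Packing and covering in self-similar sets\<close>

lemma similarity_of_self_similar:
  "self_similar_by m f (\<lambda>_. \<rho>) S \<Longrightarrow> i < m \<Longrightarrow> 0 < \<rho> \<and> \<rho> < 1 \<and> (\<forall>x y. dist (f i x) (f i y) = \<rho> * dist x y)"
  unfolding self_similar_by_def contracting_similarity_def by blast

lemma similarity_inj:
  assumes "self_similar_by m f (\<lambda>_. \<rho>) S" "i < m"
  shows "inj (f i)"
proof (rule injI)
  fix x y assume "f i x = f i y"
  then have "\<rho> * dist x y = 0" using similarity_of_self_similar[OF assms] by (metis dist_self)
  then show "x = y" using similarity_of_self_similar[OF assms] by simp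
qed

lemma compact_piece:
  assumes ss: "self_similar_by m f (\<lambda>_. \<rho>) S" and i: "i < m"
  shows "compact (f i ` S)"
proof (rule compact_continuous_image)
  show "compact S" using ss unfolding self_similar_by_def by blast
  have "\<rho>-lipschitz_on S (f i)"
    using similarity_of_self_similar[OF ss i] by (intro lipschitz_onI) auto
  then show "continuous_on S (f i)" by (rule lipschitz_on_continuous_on)
qed

lemma pieces_have_positive_distance:
  fixes S :: "'a::heine_borel set"
  assumes ss: "self_similar_by m f (\<lambda>_. \<rho>) S" and sep: "strong_separation m f S"
  shows "\<exists>c>0. \<forall>i<m. \<forall>j<m. i \<noteq> j \<longrightarrow> (\<forall>x\<in>S. \<forall>y\<in>S. c \<le> dist (f i x) (f j y))"
proof -
  have "\<exists>d>0. i < m \<and> j < m \<and> i \<noteq> j \<longrightarrow> (\<forall>x\<in>S. \<forall>y\<in>S. d \<le> dist (f i x) (f j y))" for i j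
  proof (cases "i < m \<and> j < m \<and> i \<noteq> j")
    case True
    then have "f i ` S \<inter> f j ` S = {}" using sep unfolding strong_separation_def by blast
    moreover have "compact (f i ` S)" "closed (f j ` S)"
      using compact_piece[OF ss] True by (auto intro: compact_imp_closed)
    ultimately obtain d where "d > 0" "\<forall>x\<in>f i ` S. \<forall>y\<in>f j ` S. d \<le> dist x y"
      using separate_compact_closed by metis
    then show ?thesis by auto
  qed (auto intro: exI[of _ 1])
  then obtain d where d: "\<And>i j. d i j > 0"
    "\<And>i j x y. i < m \<Longrightarrow> j < m \<Longrightarrow> i \<noteq> j \<Longrightarrow> x \<in> S \<Longrightarrow> y \<in> S \<Longrightarrow> d i j \<le> dist (f i x) (f j y)"
    by metis
  define A where "A = insert 1 ((\<lambda>(i, j). d i j) ` ({..<m} \<times> {..<m}))"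
  have fin: "finite A" "A \<noteq> {}" unfolding A_def by auto
  have "Min A > 0" using fin d(1) by (auto simp: A_def)
  moreover have "Min A \<le> d i j" if "i < m" "j < m" for i j
    using fin that by (intro Min_le) (auto simp: A_def)
  ultimately show ?thesis using d(2) by (meson order_trans)
qed

text \<open>The \<open>m ^ k\<close> images of one point under the \<open>k\<close>-fold compositions: images in different
  pieces are separated by the gap \<open>c\<close> between the pieces, images in the same piece are copies, scaled
  by \<open>\<rho>\<close>, of those one level below.\<close>

lemma self_similar_packing:
  fixes S :: "'a::heine_borel set"
  assumes ss: "self_similar_by m f (\<lambda>_. \<rho>) S" and sep: "strong_separation m f S" and \<rho>: "0 < \<rho>" "\<rho> < 1"
  shows "\<exists>c>0. \<forall>k. \<exists>P\<subseteq>S. finite P \<and> card P = m ^ k \<and> (\<forall>x\<in>P. \<forall>y\<in>P. x \<noteq> y \<longrightarrow> c * \<rho> ^ k \<le> dist x y)"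
proof -
  obtain c where c: "c > 0"
    "\<And>i j x y. i < m \<Longrightarrow> j < m \<Longrightarrow> i \<noteq> j \<Longrightarrow> x \<in> S \<Longrightarrow> y \<in> S \<Longrightarrow> c \<le> dist (f i x) (f j y)"
    using pieces_have_positive_distance[OF ss sep] by metis
  have "\<exists>P\<subseteq>S. finite P \<and> card P = m ^ k \<and> (\<forall>x\<in>P. \<forall>y\<in>P. x \<noteq> y \<longrightarrow> c * \<rho> ^ k \<le> dist x y)" for k
  proof (induction k)
    case 0
    obtain x where "x \<in> S" using ss unfolding self_similar_by_def by blast
    then show ?case by (intro exI[of _ "{x}"]) auto
  next
    case (Suc k)
    then obtain P where P: "P \<subseteq> S" "finite P" "card P = m ^ k"
      "\<And>x y. x \<in> P \<Longrightarrow> y \<in> P \<Longrightarrow> x \<noteq> y \<Longrightarrow> c * \<rho> ^ k \<le> dist x y" by blast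
    let ?Q = "\<Union>i<m. f i ` P"
    have S: "S = (\<Union>i<m. f i ` S)" using ss unfolding self_similar_by_def by blast
    then have "?Q \<subseteq> S" using P(1) by blast
    moreover have "finite ?Q" using P(2) by auto
    moreover have "card ?Q = m ^ Suc k"
    proof -
      have "f i ` P \<inter> f j ` P = {}" if "i < m" "j < m" "i \<noteq> j" for i j
      proof -
        have "f i ` S \<inter> f j ` S = {}" using sep that unfolding strong_separation_def by blast
        then show ?thesis using P(1) by blast
      qed
      then have "card ?Q = (\<Sum>i<m. card (f i ` P))"
        using P(2) by (intro card_UN_disjoint) auto
      also have "\<dots> = (\<Sum>i<m. m ^ k)"
        using similarity_inj[OF ss] P(3)
        by (intro sum.cong refl) (metis card_image inj_on_subset lessThan_iff subset_UNIV)
      finally show ?thesis by simp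
    qed
    moreover have "c * \<rho> ^ Suc k \<le> dist x y" if "x \<in> ?Q" "y \<in> ?Q" "x \<noteq> y" for x y
    proof -
      obtain i u where i: "i < m" "u \<in> P" "x = f i u" using \<open>x \<in> ?Q\<close> by blast
      obtain j v where j: "j < m" "v \<in> P" "y = f j v" using \<open>y \<in> ?Q\<close> by blast
      show ?thesis
      proof (cases "i = j")
        case True
        then have "dist x y = \<rho> * dist u v"
          using similarity_of_self_similar[OF ss i(1)] i j by simp
        moreover have "u \<noteq> v" using True i j \<open>x \<noteq> y\<close> by blast
        ultimately show ?thesis using P(4)[OF i(2) j(2)] \<rho> by (simp add: mult.left_commute)
      next
        case False
        then have "c \<le> dist x y" using c(2) i j P(1) by blast
        moreover have "c * \<rho> ^ Suc k \<le> c * 1"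
          using c(1) \<rho> by (intro mult_left_mono power_le_one) auto
        ultimately show ?thesis by simp
      qed
    qed
    ultimately show ?case by blast
  qed
  then show ?thesis using c(1) by blast
qed

text \<open>Each of the \<open>m ^ k\<close> pieces of level \<open>k\<close> has diameter at most \<open>\<Delta> * \<rho> ^ k\<close>, so
  it contains at most one point of \<open>P\<close>.\<close>

lemma self_similar_covering:
  fixes S :: "'a::metric_space set"
  assumes ss: "self_similar_by m f (\<lambda>_. \<rho>) S" and \<rho>: "0 < \<rho>"
    and \<Delta>: "\<And>x y. x \<in> S \<Longrightarrow> y \<in> S \<Longrightarrow> dist x y \<le> \<Delta>"
    and P: "finite P" "P \<subseteq> S" "separated_by (\<Delta> * \<rho> ^ k) P"
  shows "card P \<le> m ^ k"
  using P
proof (induction k arbitrary: P)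
  case 0
  have "is_singleton P \<or> P = {}"
  proof (cases "P = {}")
    case False
    then obtain x where x: "x \<in> P" by blast
    have "y = x" if "y \<in> P" for y
      using 0 \<Delta>[of x y] x that unfolding separated_by_def by fastforce
    then have "P = {x}" using x by blast
    then show ?thesis by (simp add: is_singleton_def)
  qed simp
  then show ?case by (auto simp: is_singleton_altdef)
next
  case (Suc k)
  define Q where "Q i = {x \<in> S. f i x \<in> P}" for i
  have S: "S = (\<Union>i<m. f i ` S)" using ss unfolding self_similar_by_def by blast
  have "P \<subseteq> (\<Union>i<m. f i ` Q i)"
  proof
    fix x assume x: "x \<in> P"
    then have "x \<in> (\<Union>i<m. f i ` S)" using Suc.prems(2) S by blast
    then show "x \<in> (\<Union>i<m. f i ` Q i)" using x unfolding Q_def by blast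
  qed
  moreover have fin: "finite (Q i)" if "i < m" for i
  proof -
    have "finite (f i -` P)"
      using finite_vimageI[OF Suc.prems(1) similarity_inj[OF ss that]] .
    then show ?thesis by (rule rev_finite_subset) (auto simp: Q_def)
  qed
  ultimately have "card P \<le> card (\<Union>i<m. f i ` Q i)" by (intro card_mono) auto
  also have "\<dots> \<le> (\<Sum>i<m. card (f i ` Q i))" by (rule card_UN_le) simp
  also have "\<dots> \<le> (\<Sum>i<m. m ^ k)"
  proof (rule sum_mono)
    fix i assume "i \<in> {..<m}"
    then have i: "i < m" by simp
    have "separated_by (\<Delta> * \<rho> ^ k) (Q i)"
      unfolding separated_by_def
    proof (intro ballI impI)
      fix x y assume xy: "x \<in> Q i" "y \<in> Q i" "x \<noteq> y"
      then have "f i x \<noteq> f i y" using similarity_inj[OF ss i] by (auto dest: injD)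
      then have "\<Delta> * \<rho> ^ Suc k < dist (f i x) (f i y)"
        using xy Suc.prems(3) unfolding Q_def separated_by_def by blast
      also have "\<dots> = \<rho> * dist x y" using similarity_of_self_similar[OF ss i] by blast
      finally have "\<rho> * (\<Delta> * \<rho> ^ k) < \<rho> * dist x y" by (simp add: mult.left_commute)
      then show "\<Delta> * \<rho> ^ k < dist x y" using \<rho> by simp
    qed
    then have "card (Q i) \<le> m ^ k" using Suc.IH[OF fin[OF i]] by (auto simp: Q_def)
    then show "card (f i ` Q i) \<le> m ^ k" using card_image_le[OF fin[OF i], of "f i"] by linarith
  qed
  also have "\<dots> = m ^ Suc k" by simp
  finally show ?case .
qed

lemma nonpos_if_multiples_bounded:
  fixes x H :: real
  assumes "\<And>k::nat. real k * x \<le> H"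
  shows "x \<le> 0"
proof (rule ccontr)
  assume "\<not> x \<le> 0"
  then obtain k :: nat where "H < real k * x"
    using reals_Archimedean3[of x] by auto
  then show False using assms[of k] by simp
qed

text \<open>The \<open>m ^ k\<close> separated points of \<open>S\<close> at scale \<open>\<rho> ^ k\<close> remain separated in \<open>T\<close>, up to
  the bilipschitz constant, so the \<open>n ^ j\<close> pieces of \<open>T\<close> at a slightly smaller scale \<open>\<sigma> ^ j\<close> contain at
  most one each and \<open>m ^ k \<le> n ^ j\<close>. Here \<open>j\<close> is \<open>k * ln (1 / \<rho>) / ln (1 / \<sigma>)\<close> up to a bounded error,
  which disappears as \<open>k\<close> grows.\<close>

lemma embedding_dimension_comparison:
  fixes S :: "'a::heine_borel set" and T :: "'b::metric_space set"
  assumes S: "self_similar_by m f (\<lambda>_. \<rho>) S" "strong_separation m f S" "0 < \<rho>" "\<rho> < 1" "m > 0"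
    and T: "self_similar_by n h (\<lambda>_. \<sigma>) T" "0 < \<sigma>" "\<sigma> < 1" "n > 0"
    and g: "bilipschitz_embedding g S" "g ` S \<subseteq> T"
  shows "ln (real m) / ln (1 / \<rho>) \<le> ln (real n) / ln (1 / \<sigma>)"
proof -
  obtain c where c: "c > 0" "\<And>k. \<exists>P\<subseteq>S. finite P \<and> card P = m ^ k \<and>
      (\<forall>x\<in>P. \<forall>y\<in>P. x \<noteq> y \<longrightarrow> c * \<rho> ^ k \<le> dist x y)"
    using self_similar_packing[OF S(1,2,3,4)] by metis
  obtain L where L: "L > 0" "\<And>x y. x \<in> S \<Longrightarrow> y \<in> S \<Longrightarrow> dist x y \<le> L * dist (g x) (g y)"
    using g(1) unfolding bilipschitz_embedding_def by blast
  have bT: "bounded T" using T(1) compact_imp_bounded unfolding self_similar_by_def by blast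
  define \<Delta> where "\<Delta> = diameter T + 1"
  have \<Delta>: "\<Delta> > 0" "\<And>x y. x \<in> T \<Longrightarrow> y \<in> T \<Longrightarrow> dist x y \<le> \<Delta>"
    using diameter_ge_0[OF bT] diameter_bounded_bound[OF bT] by (fastforce simp: \<Delta>_def)+
  have count: "m ^ k \<le> n ^ j" if less: "L * (\<Delta> * \<sigma> ^ j) < c * \<rho> ^ k" for k j
  proof -
    obtain P where P: "P \<subseteq> S" "finite P" "card P = m ^ k"
      "\<And>x y. x \<in> P \<Longrightarrow> y \<in> P \<Longrightarrow> x \<noteq> y \<Longrightarrow> c * \<rho> ^ k \<le> dist x y" using c(2)[of k] by blast
    have "separated_by (\<Delta> * \<sigma> ^ j) (g ` P)"
      unfolding separated_by_def
    proof (intro ballI impI)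
      fix x y assume "x \<in> g ` P" "y \<in> g ` P" "x \<noteq> y"
      then obtain u v where uv: "u \<in> P" "v \<in> P" "x = g u" "y = g v" "u \<noteq> v" by blast
      have "L * (\<Delta> * \<sigma> ^ j) < c * \<rho> ^ k" by (rule less)
      also have "\<dots> \<le> dist u v" using P(4) uv by blast
      also have "\<dots> \<le> L * dist x y" using L(2) uv P(1) by blast
      finally show "\<Delta> * \<sigma> ^ j < dist x y" using L(1) by simp
    qed
    then have "card (g ` P) \<le> n ^ j"
      using self_similar_covering[OF T(1,2) \<Delta>(2)] P(1,2) g(2) by blast
    moreover have "card (g ` P) = m ^ k"
      using card_image[OF inj_on_subset[OF bilipschitz_embedding_inj_on[OF g(1)] P(1)]] P(3) by simp
    ultimately show ?thesis by simp
  qed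
  define a where "a = ln (1 / \<rho>)"
  define b where "b = ln (1 / \<sigma>)"
  have ab: "a > 0" "b > 0" using S T by (auto simp: a_def b_def)
  define H where "H = max 0 (ln (L * \<Delta> / c))"
  have lnn: "ln (real n) \<ge> 0" using T by simp
  have "real k * (ln (real m) - a * ln (real n) / b) \<le> (H / b + 1) * ln (real n)" for k
  proof -
    define j where "j = nat \<lfloor>(real k * a + H) / b\<rfloor> + 1"
    have q: "0 \<le> (real k * a + H) / b" using ab by (simp add: H_def)
    have j: "(real k * a + H) / b < real j" "real j \<le> (real k * a + H) / b + 1"
      using q unfolding j_def by linarith+
    have "ln (L * \<Delta> / c) + real k * a < real j * b"
      using j(1) ab unfolding H_def by (simp add: pos_divide_less_eq)
    then have "ln (L * (\<Delta> * \<sigma> ^ j)) < ln (c * \<rho> ^ k)"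
      using L(1) \<Delta>(1) c(1) S T
      by (simp add: a_def b_def ln_mult ln_div ln_realpow algebra_simps)
    then have "L * (\<Delta> * \<sigma> ^ j) < c * \<rho> ^ k"
      using L(1) \<Delta>(1) c(1) S T by (subst (asm) ln_less_cancel_iff) auto
    then have "m ^ k \<le> n ^ j" by (rule count)
    then have "real m ^ k \<le> real n ^ j" by (metis of_nat_le_iff of_nat_power)
    then have "ln (real m ^ k) \<le> ln (real n ^ j)" using S T by (subst ln_le_cancel_iff) auto
    then have "real k * ln (real m) \<le> real j * ln (real n)" using S T by (simp add: ln_realpow)
    also have "\<dots> \<le> ((real k * a + H) / b + 1) * ln (real n)"
      using j(2) lnn by (rule mult_right_mono)
    finally show ?thesis by (simp add: add_divide_distrib algebra_simps)
  qed
  then have "ln (real m) - a * ln (real n) / b \<le> 0" by (rule nonpos_if_multiples_bounded)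
  then show ?thesis using ab unfolding a_def[symmetric] b_def[symmetric]
    by (simp add: field_simps)
qed

text \<open>The balls of radius \<open>c * \<rho> ^ k / 2\<close> around the \<open>m ^ k\<close> separated points are disjoint
  and lie in a fixed ball. Comparing volumes bounds \<open>(m * \<rho> ^ DIM('a)) ^ k\<close> independently of \<open>k\<close>.\<close>

lemma self_similar_dimension_le_DIM:
  fixes S :: "'a::euclidean_space set"
  assumes S: "self_similar_by m f (\<lambda>_. \<rho>) S" "strong_separation m f S" "0 < \<rho>" "\<rho> < 1" "m > 0"
  shows "ln (real m) / ln (1 / \<rho>) \<le> real DIM('a)"
proof -
  let ?n = "DIM('a)"
  let ?V = "unit_ball_vol (real ?n)"
  obtain c where c: "c > 0" "\<And>k. \<exists>P\<subseteq>S. finite P \<and> card P = m ^ k \<and>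
      (\<forall>x\<in>P. \<forall>y\<in>P. x \<noteq> y \<longrightarrow> c * \<rho> ^ k \<le> dist x y)"
    using self_similar_packing[OF S(1,2,3,4)] by metis
  have "bounded S" using S(1) compact_imp_bounded unfolding self_similar_by_def by blast
  then obtain R where R: "R > 0" "\<And>x. x \<in> S \<Longrightarrow> norm x \<le> R" using bounded_pos by metis
  have V: "?V > 0" by (simp add: unit_ball_vol_pos)
  have vol: "real m ^ k * (c * \<rho> ^ k / 2) ^ ?n \<le> (R + c) ^ ?n" for k
  proof -
    define s where "s = c * \<rho> ^ k / 2"
    have s: "0 < s" "s \<le> c"
      using c(1) S(3,4) power_le_one[of \<rho> k] mult_left_le[of "\<rho> ^ k" c] by (auto simp: s_def)
    obtain P where P: "P \<subseteq> S" "finite P" "card P = m ^ k"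
      "\<And>x y. x \<in> P \<Longrightarrow> y \<in> P \<Longrightarrow> x \<noteq> y \<Longrightarrow> c * \<rho> ^ k \<le> dist x y" using c(2)[of k] by blast
    have "real m ^ k * (?V * s ^ ?n) = (\<Sum>x\<in>P. measure lborel (ball x s))"
      using s P(3) by (simp add: content_ball)
    also have "\<dots> = measure lborel (\<Union>x\<in>P. ball x s)"
    proof (rule measure_finite_Union[symmetric, OF P(2)])
      show "disjoint_family_on (\<lambda>x. ball x s) P"
        unfolding disjoint_family_on_def
      proof (intro ballI impI equals0I)
        fix x y z assume xy: "x \<in> P" "y \<in> P" "x \<noteq> y" "z \<in> ball x s \<inter> ball y s"
        have "dist x y \<le> dist x z + dist y z" by (metis dist_commute dist_triangle)
        then have "dist x y < 2 * s" using xy(4) by simp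
        then show False using P(4)[OF xy(1-3)] by (simp add: s_def)
      qed
      show "emeasure lborel (ball x s) \<noteq> \<infinity>" if "x \<in> P" for x
        using emeasure_bounded_finite[of "ball x s"] by simp
    qed auto
    also have "\<dots> \<le> measure lborel (ball (0::'a) (R + c))"
    proof (rule measure_mono_fmeasurable)
      show "(\<Union>x\<in>P. ball x s) \<subseteq> ball (0::'a) (R + c)"
      proof
        fix z assume "z \<in> (\<Union>x\<in>P. ball x s)"
        then obtain x where x: "x \<in> P" "dist x z < s" by auto
        have "norm z \<le> norm x + dist x z" by (metis dist_norm norm_minus_commute norm_triangle_sub)
        then show "z \<in> ball (0::'a) (R + c)" using x R(2)[of x] P(1) s by auto
      qed
      show "(\<Union>x\<in>P. ball x s) \<in> sets lborel" using P(2) by auto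
      show "ball (0::'a) (R + c) \<in> fmeasurable lborel"
        using emeasure_bounded_finite[of "ball (0::'a) (R + c)"] by (intro fmeasurableI) auto
    qed
    also have "\<dots> = ?V * (R + c) ^ ?n" using R c by (simp add: content_ball)
    finally have "?V * (real m ^ k * s ^ ?n) \<le> ?V * (R + c) ^ ?n" by (simp add: mult_ac)
    then show ?thesis using V unfolding s_def by simp
  qed
  have "real k * (ln (real m) - real ?n * ln (1 / \<rho>)) \<le> real ?n * (ln (R + c) - ln (c / 2))" for k
  proof -
    have "ln (real m ^ k * (c * \<rho> ^ k / 2) ^ ?n) \<le> ln ((R + c) ^ ?n)"
      using vol[of k] c R S by (subst ln_le_cancel_iff) auto
    moreover have "ln (c * \<rho> ^ k / 2) = ln (c / 2) + real k * ln \<rho>"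
      using c S by (simp add: ln_mult ln_div ln_realpow)
    ultimately have "real k * ln (real m) + real ?n * (ln (c / 2) + real k * ln \<rho>) \<le> real ?n * ln (R + c)"
      using c R S by (simp add: ln_mult ln_realpow)
    then show ?thesis using S by (simp add: ln_div algebra_simps)
  qed
  then have "ln (real m) - real ?n * ln (1 / \<rho>) \<le> 0" by (rule nonpos_if_multiples_bounded)
  then show ?thesis using S by (simp add: pos_divide_le_eq)
qed

text \<open>A connected subset lies in a single piece, since the pieces are closed and
  disjoint. Pulled back by the similarity, it is again a connected subset, \<open>1 / \<rho>\<close> times as large.\<close>

lemma connected_subset_of_self_similar:
  fixes S :: "'a::heine_borel set"
  assumes ss: "self_similar_by m f (\<lambda>_. \<rho>) S" and sep: "strong_separation m f S" and \<rho>: "0 < \<rho>"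
    and \<Delta>: "\<And>x y. x \<in> S \<Longrightarrow> y \<in> S \<Longrightarrow> dist x y \<le> \<Delta>"
    and T: "connected T" "T \<subseteq> S" "x \<in> T" "y \<in> T"
  shows "dist x y \<le> \<Delta> * \<rho> ^ k"
  using T
proof (induction k arbitrary: T x y)
  case 0
  then show ?case using \<Delta> by auto
next
  case (Suc k)
  have S: "S = (\<Union>i<m. f i ` S)" using ss unfolding self_similar_by_def by blast
  then obtain i where i: "i < m" "x \<in> f i ` S" using Suc.prems by blast
  let ?A = "f i ` S" and ?B = "\<Union>j\<in>{..<m} - {i}. f j ` S"
  have closed: "closed ?A" "closed ?B"
    using compact_piece[OF ss] i(1) by (auto intro!: closed_UN compact_imp_closed)
  have cover: "T \<subseteq> ?A \<union> ?B" using S Suc.prems(2) by blast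
  have "f i ` S \<inter> f j ` S = {}" if "j < m" "j \<noteq> i" for j
    using sep i(1) that unfolding strong_separation_def by metis
  then have disj: "?A \<inter> ?B = {}" by blast
  have "?A \<inter> T \<noteq> {}" using i Suc.prems(3) by blast
  then have "?B \<inter> T = {}"
    using connected_closedD[OF Suc.prems(1) _ cover closed] disj by blast
  then have TA: "T \<subseteq> f i ` S" using cover by blast
  note sim = similarity_of_self_similar[OF ss i(1)]
  define h where "h = inv_into UNIV (f i)"
  have h: "h (f i u) = u" for u unfolding h_def using similarity_inj[OF ss i(1)] by simp
  have "(1 / \<rho>)-lipschitz_on T h"
  proof (rule lipschitz_onI)
    fix u v assume "u \<in> T" "v \<in> T"
    then obtain a b where "u = f i a" "v = f i b" using TA by blast
    then show "dist (h u) (h v) \<le> 1 / \<rho> * dist u v" using sim by (simp add: h)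
  qed (use \<rho> in simp)
  then have "connected (h ` T)"
    by (intro connected_continuous_image lipschitz_on_continuous_on Suc.prems(1))
  moreover have "h ` T \<subseteq> S" using TA h by force
  ultimately have "dist (h x) (h y) \<le> \<Delta> * \<rho> ^ k" using Suc.IH Suc.prems(3,4) by blast
  moreover have "dist x y = \<rho> * dist (h x) (h y)"
  proof -
    obtain a b where "x = f i a" "y = f i b" using TA Suc.prems(3,4) by blast
    then show ?thesis using sim by (simp add: h)
  qed
  ultimately show ?case using \<rho> by (simp add: mult.left_commute)
qed

section \<open>The embedding dimension\<close>

definition host_dimensions :: "'a::euclidean_space set \<Rightarrow> real set" where
  "host_dimensions A = {s. \<exists>m f r (S :: 'a set) g.
     self_similar_by m f r S \<and> homogeneous_ratios m r \<and> strong_separation m f S \<and>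
     bilipschitz_embedding g A \<and> g ` A \<subseteq> S \<and> s = similarity_dimension m r}"

text \<open>On compact sets this is the largest of the functions that satisfy \<open>dimension_like\<close>:
  a host bounds each of them from above, by invariance and monotonicity.\<close>

definition embedding_dimension :: "'a::euclidean_space set \<Rightarrow> real" where
  "embedding_dimension A = Inf (insert (real DIM('a)) (host_dimensions A))"

lemma host_dimensionsE:
  fixes A :: "'a::euclidean_space set"
  assumes "s \<in> host_dimensions A"
  obtains n h \<sigma> and T :: "'a set" and g where
    "self_similar_by n h (\<lambda>_. \<sigma>) T" "strong_separation n h T" "0 < \<sigma>" "\<sigma> < 1" "n > 0"
    "bilipschitz_embedding g A" "g ` A \<subseteq> T" "s = ln (real n) / ln (1 / \<sigma>)"
proof -
  obtain n h r and T :: "'a set" and g where *: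
    "self_similar_by n h r T" "homogeneous_ratios n r" "strong_separation n h T"
    "bilipschitz_embedding g A" "g ` A \<subseteq> T" "s = similarity_dimension n r"
    using assms unfolding host_dimensions_def by blast
  obtain \<sigma> where "self_similar_by n h (\<lambda>_. \<sigma>) T" "0 < \<sigma>" "\<sigma> < 1" "n > 0"
    "similarity_dimension n r = ln (real n) / ln (1 / \<sigma>)"
    using homogeneous_normal_form[OF *(1,2)] by blast
  with * show ?thesis using that by metis
qed

lemma host_dimensions_nonneg: "s \<in> host_dimensions A \<Longrightarrow> 0 \<le> s"
  by (erule host_dimensionsE) simp

lemma host_dimensions_bdd_below: "bdd_below (insert (real n) (host_dimensions A))"
  using host_dimensions_nonneg by (intro bdd_belowI[of _ 0]) auto

lemma embedding_dimension_mono: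
  fixes A B :: "'a::euclidean_space set"
  assumes "bilipschitz_embedding h A" "h ` A \<subseteq> B"
  shows "embedding_dimension A \<le> embedding_dimension B"
proof -
  have "host_dimensions B \<subseteq> host_dimensions A"
  proof
    fix s assume "s \<in> host_dimensions B"
    then obtain m f r and S :: "'a set" and g where *: "self_similar_by m f r S" "homogeneous_ratios m r"
      "strong_separation m f S" "bilipschitz_embedding g B" "g ` B \<subseteq> S" "s = similarity_dimension m r"
      unfolding host_dimensions_def by blast
    have "bilipschitz_embedding (g \<circ> h) A"
      by (rule bilipschitz_embedding_compose[OF assms(1) *(4) assms(2)])
    moreover have "(g \<circ> h) ` A \<subseteq> S" using assms(2) *(5) by auto
    ultimately show "s \<in> host_dimensions A" using * unfolding host_dimensions_def by blast
  qed
  then show ?thesis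
    unfolding embedding_dimension_def
    by (intro cInf_superset_mono host_dimensions_bdd_below) auto
qed

lemma bilipschitz_embedding_id: "bilipschitz_embedding (\<lambda>x. x) A"
  unfolding bilipschitz_embedding_def by (intro exI[of _ 1]) auto

lemma embedding_dimension_self_similar:
  fixes S :: "'a::euclidean_space set"
  assumes S: "self_similar_by m f r S" "homogeneous_ratios m r" "strong_separation m f S"
  shows "embedding_dimension S = similarity_dimension m r"
proof (rule antisym)
  have "similarity_dimension m r \<in> host_dimensions S"
    unfolding host_dimensions_def using S bilipschitz_embedding_id[of S]
    by (intro CollectI exI[of _ m] exI[of _ f] exI[of _ r] exI[of _ S] exI[of _ "\<lambda>x. x"]) auto
  then show "embedding_dimension S \<le> similarity_dimension m r"
    unfolding embedding_dimension_def by (intro cInf_lower host_dimensions_bdd_below) auto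
  obtain \<rho> where \<rho>: "self_similar_by m f (\<lambda>_. \<rho>) S" "0 < \<rho>" "\<rho> < 1" "m > 0"
    "similarity_dimension m r = ln (real m) / ln (1 / \<rho>)"
    using homogeneous_normal_form[OF S(1,2)] by blast
  show "similarity_dimension m r \<le> embedding_dimension S"
    unfolding embedding_dimension_def
  proof (rule cInf_greatest)
    fix s assume "s \<in> insert (real DIM('a)) (host_dimensions S)"
    then consider "s = real DIM('a)" | "s \<in> host_dimensions S" by blast
    then show "similarity_dimension m r \<le> s"
    proof cases
      case 1
      then show ?thesis
        using self_similar_dimension_le_DIM[OF \<rho>(1) S(3) \<rho>(2,3,4)] \<rho>(5) by simp
    next
      case 2
      then show ?thesis
        by (rule host_dimensionsE)
           (use embedding_dimension_comparison[OF \<rho>(1) S(3) \<rho>(2,3,4)] \<rho>(5) in simp)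
    qed
  qed simp
qed

lemma dimension_like_embedding_dimension:
  "dimension_like (embedding_dimension :: 'a::euclidean_space set \<Rightarrow> real)"
proof -
  have 1: "0 \<le> embedding_dimension K" for K :: "'a set"
    unfolding embedding_dimension_def using host_dimensions_nonneg by (intro cInf_greatest) auto
  have 2: "embedding_dimension K \<le> real DIM('a)" for K :: "'a set"
    unfolding embedding_dimension_def by (intro cInf_lower host_dimensions_bdd_below) auto
  have 3: "embedding_dimension A = embedding_dimension B"
    if "bilipschitz_equivalent A B" for A B :: "'a set"
    using bilipschitz_equivalent_embeddings[OF that] embedding_dimension_mono
    by (metis order_antisym order_refl)
  have 4: "embedding_dimension A \<le> embedding_dimension B" if "A \<subseteq> B" for A B :: "'a set"
    by (rule embedding_dimension_mono[OF bilipschitz_embedding_id]) (use that in auto)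
  show ?thesis
    unfolding dimension_like_def
    by (intro conjI allI impI; (elim conjE)?;
        (rule 1 2 | erule 3 | erule 4 | (rule embedding_dimension_self_similar, assumption+)))
qed

text \<open>The image of a connected set in a self-similar host would be connected, so it would have
  diameter at most \<open>diameter T * \<sigma> ^ k\<close> for every \<open>k\<close>. Hence there is no host.\<close>

lemma embedding_dimension_connected:
  fixes A :: "'a::euclidean_space set"
  assumes A: "connected A" "x \<in> A" "y \<in> A" "x \<noteq> y"
  shows "embedding_dimension A = real DIM('a)"
proof -
  have "host_dimensions A = {}"
  proof (rule equals0I)
    fix s assume "s \<in> host_dimensions A"
    then obtain n h \<sigma> and T :: "'a set" and g where
      T: "self_similar_by n h (\<lambda>_. \<sigma>) T" "strong_separation n h T" "0 < \<sigma>" "\<sigma> < 1"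
      and g: "bilipschitz_embedding g A" "g ` A \<subseteq> T"
      by (rule host_dimensionsE)
    have bT: "bounded T" using T(1) compact_imp_bounded unfolding self_similar_by_def by blast
    have "connected (g ` A)"
      by (intro connected_continuous_image bilipschitz_embedding_continuous_on g(1) A(1))
    then have "dist (g x) (g y) \<le> diameter T * \<sigma> ^ k" for k
      using connected_subset_of_self_similar[OF T(1,2,3) diameter_bounded_bound[OF bT]] g(2) A(2,3)
      by blast
    moreover have "(\<lambda>k. diameter T * \<sigma> ^ k) \<longlonglongrightarrow> diameter T * 0"
      using T(3,4) by (intro tendsto_mult_left LIMSEQ_realpow_zero) auto
    ultimately have "dist (g x) (g y) \<le> diameter T * 0"
      by (intro LIMSEQ_le_const) auto
    then show False
      using bilipschitz_embedding_inj_on[OF g(1)] A(2-4) by (simp add: inj_on_def)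
  qed
  then show ?thesis unfolding embedding_dimension_def by simp
qed

lemma assouad_dim_line_le_1:
  fixes X :: "'a::euclidean_space set"
  assumes "norm b = 1" "X \<subseteq> range (\<lambda>t. t *\<^sub>R b)"
  shows "assouad_dim X \<le> 1"
  unfolding assouad_dim_def
proof (rule cInf_lower)
  show "1 \<in> {\<alpha>. 0 \<le> \<alpha> \<and> (\<exists>C>0. \<forall>x\<in>X. \<forall>r R. 0 < r \<and> r < R \<longrightarrow>
          real (covering_number (cball x R \<inter> X) r) \<le> C * (R / r) powr \<alpha>)}"
    using covering_number_line_le[OF assms] by (intro CollectI conjI exI[of _ "5::real"]) auto
  show "bdd_below {\<alpha>. 0 \<le> \<alpha> \<and> (\<exists>C>0. \<forall>x\<in>X. \<forall>r R. 0 < r \<and> r < R \<longrightarrow>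
          real (covering_number (cball x R \<inter> X) r) \<le> C * (R / r) powr \<alpha>)}"
    by (rule bdd_belowI[of _ 0]) auto
qed

text \<open>The segment from \<open>0\<close> to a unit vector is connected, but one-dimensional for the Assouad
  dimension.\<close>

lemma exists_dimension_above_assouad_dim:
  assumes "DIM('a::euclidean_space) > 1"
  shows "\<exists>(D :: 'a set \<Rightarrow> real) K. dimension_like D \<and> compact K \<and> D K > assouad_dim K"
proof -
  obtain b :: 'a where "b \<in> Basis" using nonempty_Basis by blast
  then have b: "norm b = 1" by (rule norm_Basis)
  let ?K = "(\<lambda>t. t *\<^sub>R b) ` {0..1::real}"
  have cont: "continuous_on {0..1::real} (\<lambda>t. t *\<^sub>R b)" by (intro continuous_intros)
  have "compact ?K" by (rule compact_continuous_image[OF cont]) simp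
  moreover have "connected ?K" by (rule connected_continuous_image[OF cont]) simp
  moreover have "0 *\<^sub>R b \<in> ?K" "1 *\<^sub>R b \<in> ?K" by (auto simp del: scaleR_zero_left scaleR_one)
  moreover have "0 *\<^sub>R b \<noteq> 1 *\<^sub>R b" using b by auto
  moreover have "assouad_dim ?K \<le> 1" by (rule assouad_dim_line_le_1[OF b]) auto
  ultimately have "compact ?K" "assouad_dim ?K < embedding_dimension ?K"
    using embedding_dimension_connected[of ?K "0 *\<^sub>R b" "1 *\<^sub>R b"] assms by auto
  then show ?thesis using dimension_like_embedding_dimension by blast
qed

theorem theorem1p2:
  "(\<forall>D :: 'a::euclidean_space set \<Rightarrow> real. dimension_like D \<longrightarrow>
      (\<forall>K. compact K \<longrightarrow> modified_lower_dim K \<le> D K)) \<and>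
   (DIM('a) = 1 \<longrightarrow>
      (\<forall>D :: 'a set \<Rightarrow> real. dimension_like D \<longrightarrow>
         (\<forall>K. compact K \<longrightarrow> D K \<le> assouad_dim K))) \<and>
   (DIM('a) > 1 \<longrightarrow>
      (\<exists>(D :: 'a set \<Rightarrow> real) K. dimension_like D \<and> compact K \<and> D K > assouad_dim K))"
  using modified_lower_dim_le assouad_dim_ge exists_dimension_above_assouad_dim by blast

end
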